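(* Let $d \ge 1$. Then, as $N \to \infty$, \[ D^N_\beta = \begin{cases} \Theta(1/\beta), & \text{if } 1/N \ll \beta \ll 1, \\ \Theta(N), & \text{if } \beta = O(1/N). \end{cases} \] Moreover, there exist a non-increasing function $f^d : \mathbb{R}^+ \to \mathbb{R}^+$ and a countable set $\mathcal{C}^d \subset \mathbb{R}^+$ such that if $c \in \mathbb{R}^+ \setminus \mathcal{C}^d$ and $\beta = c/N$ then, as $N \to \infty$, \[ D^N_\beta = N f^d(c) \times (1 + o(1)). \]
   Context: Fix a dimension $d \ge 1$ and let $|\cdot|$ be the Euclidean norm on $\mathbb{R}^d$. For $N \ge 1$ let $\mathcal{T}^N = \{1,\dots,N\}^d \subset \mathbb{Z}^d$ and let $\pi^N$ be the set of all bijections $\pi : \mathcal{T}^N \to \mathcal{T}^N$. For $\pi \in \pi^N$ define the energy $H^N(\pi) = \sum_{x \in \mathcal{T}^N} |x - \pi(x)|$. For $\beta \ge 0$ let $P^N_\beta$ be the probability measure on $\pi^N$ given by $P^N_\beta(\pi) = \frac{1}{Z^N_\beta} e^{-\beta H^N(\pi)}$, where $Z^N_\beta = \sum_{\pi \in \pi^N} e^{-\beta H^N(\pi)}$ is the partition function. The mean displacement per site is $D^N_\beta = \frac{1}{N^d} \sum_{x \in \mathcal{T}^N} E[|x - \pi(x)|] = \frac{1}{N^d} E[H^N(\pi)]$, where $E$ is expectation under $P^N_\beta$. $\mathbb{R}^+$ denotes the positive reals. The parameter $\beta = \beta(N)$ varies with $N$. For functions $f,g$ of $N$: $f \ll g$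 (or $f = o(g)$) means $|f|/|g| \to 0$ as $N \to \infty$; $f = O(g)$ means there is a constant $C>0$ with $|f|/|g| < C$ for all sufficiently large $N$; $f = \Theta(g)$ means $f = O(g)$ and $g = O(f)$. *)

theory Defs
  imports
    "HOL-Probability.Probability"
    "HOL-Combinatorics.Combinatorics"
    "HOL-Library.Landau_Symbols"
begin

text \<open>The dimension is \<open>d = CARD('d)\<close>; it is at least \<open>1\<close> because every type is inhabited.
  Lattice points are taken as vectors in \<open>real ^ 'd\<close>, so that \<^const>\<open>norm\<close> is the Euclidean norm.\<close>

definition lattice_box :: "nat \<Rightarrow> (real ^ 'd::finite) set" where
  "lattice_box N = {x. \<forall>i. x $ i \<in> real ` {1..N}}"

text \<open>Bijections of the box onto itself are represented by \<^const>\<open>permutes\<close>, i.e. each is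
  extended by the identity outside the box.\<close>

definition perms :: "nat \<Rightarrow> (real ^ 'd::finite \<Rightarrow> real ^ 'd) set" where
  "perms N = {\<pi>. \<pi> permutes lattice_box N}"

definition energy :: "nat \<Rightarrow> (real ^ 'd::finite \<Rightarrow> real ^ 'd) \<Rightarrow> real" where
  "energy N \<pi> = (\<Sum>x\<in>lattice_box N. norm (x - \<pi> x))"

definition partition_fun :: "'d::finite itself \<Rightarrow> nat \<Rightarrow> real \<Rightarrow> real" where
  "partition_fun _ N \<beta> = (\<Sum>\<pi>\<in>(perms N :: (real ^ 'd \<Rightarrow> real ^ 'd) set). exp (- \<beta> * energy N \<pi>))"

definition gibbs :: "nat \<Rightarrow> real \<Rightarrow> (real ^ 'd::finite \<Rightarrow> real ^ 'd) measure" where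
  "gibbs N \<beta> = point_measure (perms N)
     (\<lambda>\<pi>. ennreal (exp (- \<beta> * energy N \<pi>) / partition_fun TYPE('d) N \<beta>))"

definition mean_displacement :: "'d::finite itself \<Rightarrow> nat \<Rightarrow> real \<Rightarrow> real" where
  "mean_displacement _ N \<beta> =
     1 / real N ^ CARD('d) *
     (\<Sum>x\<in>lattice_box N. \<integral>\<pi>. norm (x - \<pi> x) \<partial>(gibbs N \<beta> :: (real ^ 'd \<Rightarrow> real ^ 'd) measure))"

lemma finite_lattice_box [simp]: "finite (lattice_box N :: (real ^ 'd::finite) set)"
proof -
  have "(lattice_box N :: (real ^ 'd) set) \<subseteq> vec_lambda ` (UNIV \<rightarrow>\<^sub>E real ` {1..N})"
  proof
    fix x :: "real ^ 'd"
    assume "x \<in> lattice_box N"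
    then have "vec_nth x \<in> UNIV \<rightarrow>\<^sub>E real ` {1..N}"
      by (auto simp: lattice_box_def PiE_def)
    then show "x \<in> vec_lambda ` (UNIV \<rightarrow>\<^sub>E real ` {1..N})"
      by (metis image_eqI vec_nth_inverse)
  qed
  then show ?thesis
    by (rule finite_subset) (intro finite_imageI finite_PiE, auto)
qed

lemma finite_perms [simp]: "finite (perms N :: (real ^ 'd::finite \<Rightarrow> real ^ 'd) set)"
  by (simp add: perms_def finite_permutations)

lemma partition_fun_pos: "partition_fun TYPE('d::finite) N \<beta> > 0"
proof -
  have "id \<in> (perms N :: (real ^ 'd \<Rightarrow> real ^ 'd) set)"
    by (simp add: perms_def permutes_id)
  then show ?thesis
    unfolding partition_fun_def by (intro sum_pos) auto
qed

lemma prob_space_gibbs: "prob_space (gibbs N \<beta> :: (real ^ 'd::finite \<Rightarrow> real ^ 'd) measure)"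
proof -
  let ?Z = "partition_fun TYPE('d) N \<beta>"
  let ?w = "\<lambda>\<pi> :: real ^ 'd \<Rightarrow> real ^ 'd. exp (- \<beta> * energy N \<pi>) / ?Z"
  have nn: "0 \<le> ?w \<pi>" for \<pi>
    using partition_fun_pos[where 'd='d, of N \<beta>] by simp
  have "(\<Sum>\<pi>\<in>perms N. ?w \<pi>) = 1"
    using partition_fun_pos[where 'd='d, of N \<beta>]
    by (simp add: sum_divide_distrib[symmetric] partition_fun_def)
  then have "(\<Sum>\<pi>\<in>perms N. ennreal (?w \<pi>)) = 1"
    using nn by (simp add: sum_ennreal)
  then show ?thesis
    unfolding gibbs_def
    by (intro prob_spaceI) (simp add: space_point_measure emeasure_point_measure_finite)
qed

lemma integral_gibbs:
  fixes g :: "(real ^ 'd::finite \<Rightarrow> real ^ 'd) \<Rightarrow> real"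
  shows "(\<integral>\<pi>. g \<pi> \<partial>gibbs N \<beta>) =
    (\<Sum>\<pi>\<in>perms N. exp (- \<beta> * energy N \<pi>) / partition_fun TYPE('d) N \<beta> * g \<pi>)"
  unfolding gibbs_def
  by (subst lebesgue_integral_point_measure_finite)
     (auto simp: less_imp_le[OF partition_fun_pos])

lemma mean_displacement_eq_energy:
  "mean_displacement TYPE('d::finite) N \<beta> =
    1 / real N ^ CARD('d) *
    (\<integral>\<pi>. energy N \<pi> \<partial>(gibbs N \<beta> :: (real ^ 'd \<Rightarrow> real ^ 'd) measure))"
  unfolding mean_displacement_def integral_gibbs energy_def sum_distrib_left
  by (subst (2) sum.swap) simp

end

theory Submission
  imports Defs
begin

text \<open>The Gibbs inequality \<open>ln Z(\<gamma>) \<ge> ln Z(\<beta>) - (\<gamma> - \<beta>) E[H]\<close> turns two-sided bounds on the partition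
  function into bounds on the mean energy. \<open>Z(\<beta>)\<close> is the permanent of the matrix
  \<open>exp (-\<beta> \<bar>x - y\<bar>)\<close>: it is at most the product of the row sums, and at least the contribution of the
  permutations that preserve blocks of side about \<open>1/\<beta>\<close>. Both bounds are \<open>\<beta> ^ (-d N ^ d)\<close> up to a factor
  exponential in \<open>N ^ d\<close>, which gives the two \<open>\<Theta>\<close> statements.

  For \<open>\<beta> = c / N\<close>, coarse-graining into \<open>M ^ d\<close> blocks changes \<open>ln Z / N ^ d\<close> by \<open>O(1/M)\<close>. The permanent of a
  block-constant matrix with \<open>m\<close> points per block is, up to factorials, a supermultiplicative function of
  \<open>m\<close>, so Fekete's lemma yields convergence of \<open>(ln Z - ln (N ^ d)!) / N ^ d\<close> for every \<open>c\<close>. The limit is convex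
  in \<open>c\<close>, and \<open>D / N\<close> converges to minus its derivative wherever the one-sided derivatives agree.\<close>

section \<open>Permanents\<close>

lemma card_permutes_fibers:
  fixes f b :: "'a \<Rightarrow> 'b"
  assumes S: "finite S" and I: "finite I" and fI: "f ` S \<subseteq> I" and bI: "b ` S \<subseteq> I"
    and eq: "\<And>i. i \<in> I \<Longrightarrow> card {x\<in>S. f x = i} = card {x\<in>S. b x = i}"
  shows "card {\<pi>. \<pi> permutes S \<and> (\<forall>x\<in>S. b (\<pi> x) = f x)} = (\<Prod>i\<in>I. fact (card {x\<in>S. b x = i}))"
proof -
  define F where "F i = {x\<in>S. f x = i}" for i
  define B where "B i = {x\<in>S. b x = i}" for i
  define X where "X i = {g \<in> F i \<rightarrow>\<^sub>E B i. inj_on g (F i)}" for i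
  define P where "P = {\<pi>. \<pi> permutes S \<and> (\<forall>x\<in>S. b (\<pi> x) = f x)}"
  have fin [simp]: "finite (F i)" "finite (B i)" for i
    using S by (auto simp: F_def B_def)
  have cX: "card (X i) = fact (card (B i))" if "i \<in> I" for i
    using eq[OF that] card_inj_on_subset_funcset[of "F i" "B i" "F i"]
    by (simp add: X_def F_def[symmetric] B_def[symmetric] fact_prod_rev)
  define p where "p G x = (if x \<in> S then G (f x) x else x)" for G :: "'b \<Rightarrow> 'a \<Rightarrow> 'a" and x
  define q where "q \<pi> = (\<lambda>i\<in>I. restrict \<pi> (F i))" for \<pi> :: "'a \<Rightarrow> 'a"
  have memX: "G (f x) \<in> X (f x)" if "G \<in> PiE I X" "x \<in> S" for G x
    using that fI by (auto simp: PiE_iff)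
  have memB: "G (f x) x \<in> S" "b (G (f x) x) = f x" if "G \<in> PiE I X" "x \<in> S" for G x
    using memX[OF that] that by (auto simp: X_def F_def B_def PiE_iff)
  have "bij_betw p (PiE I X) P"
  proof (rule bij_betw_byWitness[where f' = q])
    show "\<forall>G\<in>PiE I X. q (p G) = G"
    proof
      fix G assume G: "G \<in> PiE I X"
      show "q (p G) = G"
      proof
        fix i
        show "q (p G) i = G i"
        proof (cases "i \<in> I")
          case True
          then have "G i \<in> extensional (F i)"
            using G by (auto simp: X_def PiE_iff)
          then show ?thesis using True
            by (auto simp: q_def p_def F_def restrict_def extensional_def fun_eq_iff)
        next
          case False
          then show ?thesis using G by (auto simp: q_def PiE_iff extensional_def)
        qed
      qed
    qed
    show "\<forall>\<pi>\<in>P. p (q \<pi>) = \<pi>"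
      using fI by (auto simp: P_def p_def q_def F_def fun_eq_iff permutes_def)
    show "p ` PiE I X \<subseteq> P"
    proof (rule image_subsetI)
      fix G assume G: "G \<in> PiE I X"
      have "inj_on (p G) S"
      proof (rule inj_onI)
        fix x y assume xy: "x \<in> S" "y \<in> S" "p G x = p G y"
        then have "G (f x) x = G (f y) y" by (simp add: p_def)
        moreover from this have "f x = f y" using memB(2)[OF G] xy by metis
        moreover have "inj_on (G (f x)) (F (f x))"
          using memX[OF G \<open>x \<in> S\<close>] by (simp add: X_def)
        ultimately show "x = y" using xy by (auto simp: F_def inj_on_def)
      qed
      moreover have "p G ` S \<subseteq> S" using memB(1)[OF G] by (auto simp: p_def)
      ultimately have "bij_betw (p G) S S"
        using S by (simp add: bij_betw_def endo_inj_surj)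
      then have "p G permutes S" by (rule bij_imp_permutes) (auto simp: p_def)
      then show "p G \<in> P" using memB(2)[OF G] by (auto simp: P_def p_def)
    qed
    show "q ` P \<subseteq> PiE I X"
    proof (rule image_subsetI)
      fix \<pi> assume pi: "\<pi> \<in> P"
      then have perm: "\<pi> permutes S" by (simp add: P_def)
      have "restrict \<pi> (F i) \<in> X i" for i
        using pi permutes_in_image[OF perm] permutes_inj_on[OF perm, of "F i"]
        by (auto simp: X_def P_def F_def B_def)
      then show "q \<pi> \<in> PiE I X" by (auto simp: q_def)
    qed
  qed
  then have "card P = card (PiE I X)" by (simp add: bij_betw_same_card)
  also have "\<dots> = (\<Prod>i\<in>I. card (X i))" using I by (rule card_PiE)
  finally show ?thesis by (simp add: cX P_def B_def)
qed

definition permanent :: "'a set \<Rightarrow> ('a \<Rightarrow> 'a \<Rightarrow> real) \<Rightarrow> real" where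
  "permanent S K = (\<Sum>\<pi> | \<pi> permutes S. \<Prod>x\<in>S. K x (\<pi> x))"

lemma permanent_const: "finite S \<Longrightarrow> permanent S (\<lambda>x y. t) = t ^ card S * fact (card S)"
  by (simp add: permanent_def card_permutations)

lemma permanent_mono:
  assumes "\<And>x y. x \<in> S \<Longrightarrow> y \<in> S \<Longrightarrow> 0 \<le> K x y"
    and "\<And>x y. x \<in> S \<Longrightarrow> y \<in> S \<Longrightarrow> K x y \<le> t * K' x y"
  shows "permanent S K \<le> t ^ card S * permanent S K'"
proof -
  have "permanent S K \<le> (\<Sum>\<pi> | \<pi> permutes S. \<Prod>x\<in>S. t * K' x (\<pi> x))"
    unfolding permanent_def
    by (intro sum_mono prod_mono conjI assms) (auto simp: permutes_in_image)
  also have "\<dots> = t ^ card S * permanent S K'"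
    by (simp add: permanent_def prod.distrib sum_distrib_left)
  finally show ?thesis .
qed

lemma permanent_pos:
  assumes "finite S" "\<And>x y. x \<in> S \<Longrightarrow> y \<in> S \<Longrightarrow> 0 < K x y"
  shows "0 < permanent S K"
  unfolding permanent_def using assms
  by (intro sum_pos prod_pos) (auto simp: permutes_in_image finite_permutations intro: permutes_id)

lemma permanent_le_prod_row_sums:
  assumes S: "finite S" and nn: "\<And>x y. x \<in> S \<Longrightarrow> y \<in> S \<Longrightarrow> 0 \<le> K x y"
  shows "permanent S K \<le> (\<Prod>x\<in>S. \<Sum>y\<in>S. K x y)"
proof -
  have inj: "inj_on (\<lambda>\<pi>. restrict \<pi> S) {\<pi>. \<pi> permutes S}"
  proof (rule inj_onI)
    fix \<pi> \<sigma> assume "\<pi> \<in> {\<pi>. \<pi> permutes S}" "\<sigma> \<in> {\<pi>. \<pi> permutes S}" "restrict \<pi> S = restrict \<sigma> S"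
    then show "\<pi> = \<sigma>"
      by (intro ext) (metis mem_Collect_eq permutes_not_in restrict_apply')
  qed
  have "permanent S K = (\<Sum>g\<in>(\<lambda>\<pi>. restrict \<pi> S) ` {\<pi>. \<pi> permutes S}. \<Prod>x\<in>S. K x (g x))"
    unfolding permanent_def by (simp add: sum.reindex[OF inj])
  also have "\<dots> \<le> (\<Sum>g\<in>S \<rightarrow>\<^sub>E S. \<Prod>x\<in>S. K x (g x))"
    by (intro sum_mono2 finite_PiE S prod_nonneg nn) (auto simp: permutes_in_image)
  also have "\<dots> = (\<Prod>x\<in>S. \<Sum>y\<in>S. K x y)"
    using S by (subst prod_sum_PiE) auto
  finally show ?thesis .
qed

text \<open>Composing with \<open>transpose a b\<close> splices \<open>a\<close> into the cycle just before \<open>b\<close>, so that at most two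
  factors of the product over \<open>S\<close> change.\<close>

lemma prod_transpose_bounds:
  fixes K :: "'a \<Rightarrow> 'a \<Rightarrow> real"
  assumes S: "finite S" "a \<notin> S" and b: "b \<in> insert a S" and q: "q permutes S"
    and K: "\<And>x y. x \<in> insert a S \<Longrightarrow> y \<in> insert a S \<Longrightarrow> \<delta> \<le> K x y \<and> K x y \<le> 1" and \<delta>: "0 < \<delta>"
  defines "P \<equiv> \<Prod>x\<in>insert a S. K x ((Transposition.transpose a b \<circ> q) x)"
  shows "\<delta>\<^sup>2 * (\<Prod>x\<in>S. K x (q x)) \<le> P" "\<delta> * P \<le> (\<Prod>x\<in>S. K x (q x))"
proof -
  have qa: "q a = a" using q S by (simp add: permutes_def)
  have d1: "\<delta> \<le> 1" using K[of a a] by (auto intro: order_trans)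
  have dd: "\<delta>\<^sup>2 \<le> \<delta>" using d1 \<delta> by (auto simp: power2_eq_square)
  have Kn: "0 \<le> K x y" if "x \<in> insert a S" "y \<in> insert a S" for x y
    using K[OF that] \<delta> by linarith
  have qS: "q x \<in> S \<longleftrightarrow> x \<in> S" for x using q by (simp add: permutes_in_image)
  have "\<delta>\<^sup>2 * (\<Prod>x\<in>S. K x (q x)) \<le> P \<and> \<delta> * P \<le> (\<Prod>x\<in>S. K x (q x))"
  proof (cases "b = a")
    case True
    define R where "R = (\<Prod>x\<in>S. K x (q x))"
    have R: "0 \<le> R" unfolding R_def using Kn qS by (intro prod_nonneg) auto
    have P: "P = K a a * R" using S qa True by (simp add: P_def R_def)
    have Ka: "\<delta> \<le> K a a" "K a a \<le> 1" using K[of a a] by auto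
    have "\<delta>\<^sup>2 * R \<le> K a a * R" using R Ka dd by (intro mult_right_mono) auto
    moreover have "\<delta> * (K a a * R) \<le> 1 * R"
      unfolding mult.assoc[symmetric] using R Ka d1 \<delta> Kn[of a a]
      by (intro mult_right_mono mult_le_one) auto
    ultimately show ?thesis by (simp add: P R_def)
  next
    case False
    then have bS: "b \<in> S" using b by simp
    define y where "y = inv q b"
    have qy: "q y = b" using q by (simp add: y_def permutes_inverses)
    have yS: "y \<in> S" using qS[of y] qy bS by simp
    define R where "R = (\<Prod>x\<in>S - {y}. K x (q x))"
    have R: "0 \<le> R" unfolding R_def using Kn qS by (intro prod_nonneg) auto
    have Q: "(\<Prod>x\<in>S. K x (q x)) = K y b * R"
      using prod.remove[OF S(1) yS, of "\<lambda>x. K x (q x)"] by (simp add: R_def qy)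
    have "(\<Prod>x\<in>S - {y}. K x ((Transposition.transpose a b \<circ> q) x)) = R"
      unfolding R_def
    proof (rule prod.cong[OF refl])
      fix x assume x: "x \<in> S - {y}"
      have "q x \<noteq> b" using x qy permutes_inj[OF q] by (metis DiffE injD singletonI)
      moreover have "q x \<noteq> a" using x qS[of x] S by auto
      ultimately show "K x ((Transposition.transpose a b \<circ> q) x) = K x (q x)" by simp
    qed
    then have "P = K a b * (K y a * R)"
      using S prod.remove[OF S(1) yS, of "\<lambda>x. K x ((Transposition.transpose a b \<circ> q) x)"]
      by (simp add: P_def qa qy)
    then have P: "P = (K a b * K y a) * R" by simp
    have Ka: "\<delta> \<le> K a b" "K a b \<le> 1" "\<delta> \<le> K y a" "K y a \<le> 1" "\<delta> \<le> K y b" "K y b \<le> 1"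
      using K[of a b] K[of y a] K[of y b] bS yS by auto
    have "\<delta>\<^sup>2 * K y b \<le> \<delta>\<^sup>2 * 1" using Ka by (intro mult_left_mono) auto
    also have "\<dots> \<le> K a b * K y a"
      using Ka \<delta> by (simp add: power2_eq_square mult_mono)
    finally have 1: "\<delta>\<^sup>2 * K y b * R \<le> K a b * K y a * R" using R by (rule mult_right_mono)
    have "K a b * K y a \<le> 1" using Ka \<delta> by (intro mult_le_one) auto
    then have "\<delta> * (K a b * K y a) \<le> \<delta> * 1" using \<delta> by (intro mult_left_mono) auto
    then have "\<delta> * (K a b * K y a) \<le> K y b" using Ka by linarith
    then have "\<delta> * (K a b * K y a) * R \<le> K y b * R" using R by (rule mult_right_mono)
    then show ?thesis using 1 by (simp add: P Q mult.assoc)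
  qed
  then show "\<delta>\<^sup>2 * (\<Prod>x\<in>S. K x (q x)) \<le> P" "\<delta> * P \<le> (\<Prod>x\<in>S. K x (q x))" by auto
qed

lemma permanent_insert_bounds:
  assumes S: "finite S" "a \<notin> S"
    and K: "\<And>x y. x \<in> insert a S \<Longrightarrow> y \<in> insert a S \<Longrightarrow> \<delta> \<le> K x y \<and> K x y \<le> 1" and \<delta>: "0 < \<delta>"
  shows "\<delta>\<^sup>2 * (real (Suc (card S)) * permanent S K) \<le> permanent (insert a S) K"
    and "\<delta> * permanent (insert a S) K \<le> real (Suc (card S)) * permanent S K"
proof -
  have eq: "permanent (insert a S) K = (\<Sum>b\<in>insert a S. \<Sum>q | q permutes S.
      \<Prod>x\<in>insert a S. K x ((Transposition.transpose a b \<circ> q) x))"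
    unfolding permanent_def by (rule sum_over_permutations_insert[OF S])
  have c: "real (Suc (card S)) * permanent S K = (\<Sum>b\<in>insert a S. permanent S K)"
    using S by simp
  note bounds = prod_transpose_bounds[OF S _ _ K \<delta>]
  show "\<delta>\<^sup>2 * (real (Suc (card S)) * permanent S K) \<le> permanent (insert a S) K"
    unfolding c eq unfolding permanent_def sum_distrib_left
    by (intro sum_mono bounds) auto
  show "\<delta> * permanent (insert a S) K \<le> real (Suc (card S)) * permanent S K"
    unfolding c eq unfolding permanent_def sum_distrib_left
    by (intro sum_mono bounds) auto
qed

lemma ln_permanent_subset:
  assumes T: "finite T" and ST: "S \<subseteq> T" and C: "0 \<le> C"
    and K: "\<And>x y. x \<in> T \<Longrightarrow> y \<in> T \<Longrightarrow> exp (- C) \<le> K x y \<and> K x y \<le> 1"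
  shows "\<bar>(ln (permanent T K) - ln (fact (card T))) - (ln (permanent S K) - ln (fact (card S)))\<bar>
    \<le> 2 * C * (real (card T) - real (card S))"
proof -
  have "finite (T - S)" using T by simp
  moreover have "S \<inter> (T - S) = {}" by simp
  moreover have "S \<union> (T - S) = T" using ST by blast
  moreover have "\<bar>(ln (permanent (S \<union> U) K) - ln (fact (card (S \<union> U)))) - (ln (permanent S K) - ln (fact (card S)))\<bar>
    \<le> 2 * C * real (card U)" if "finite U" "S \<inter> U = {}" "S \<union> U \<subseteq> T" for U
    using that
  proof (induction U rule: finite_induct)
    case (insert a U)
    let ?V = "S \<union> U"
    have V: "finite ?V" "a \<notin> ?V" using insert finite_subset[OF _ T] by auto
    have K': "exp (- C) \<le> K x y \<and> K x y \<le> 1" if "x \<in> insert a ?V" "y \<in> insert a ?V" for x y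
      using that insert by (intro K) auto
    have Kp: "0 < K x y" if "x \<in> insert a ?V" "y \<in> insert a ?V" for x y
      using K'[OF that] exp_gt_zero[of "-C"] by linarith
    have pV: "0 < permanent ?V K" using V Kp by (intro permanent_pos) auto
    have pa: "0 < permanent (insert a ?V) K" using V Kp by (intro permanent_pos) auto
    note b = permanent_insert_bounds[OF V K' exp_gt_zero]
    have "ln ((exp (- C))\<^sup>2 * (real (Suc (card ?V)) * permanent ?V K)) \<le> ln (permanent (insert a ?V) K)"
      using b(1) pV pa by (subst ln_le_cancel_iff) auto
    then have 1: "- (2 * C) + ln (real (Suc (card ?V))) + ln (permanent ?V K) \<le> ln (permanent (insert a ?V) K)"
      using pV by (simp add: ln_mult ln_realpow)
    have "ln (exp (- C) * permanent (insert a ?V) K) \<le> ln (real (Suc (card ?V)) * permanent ?V K)"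
      using b(2) pV pa by (subst ln_le_cancel_iff) auto
    then have 2: "- C + ln (permanent (insert a ?V) K) \<le> ln (real (Suc (card ?V))) + ln (permanent ?V K)"
      using pV pa by (simp add: ln_mult)
    have 3: "ln (fact (card (insert a ?V))) = ln (real (Suc (card ?V))) + ln (fact (card ?V))"
      using V by (simp add: ln_mult)
    show ?case using insert.IH insert.prems insert.hyps C 1 2 3 by (simp add: algebra_simps)
  qed simp
  ultimately show ?thesis using card_Diff_subset[OF finite_subset[OF ST T] ST] card_mono[OF T ST]
    by (metis of_nat_diff order_refl)
qed

section \<open>Bounds on the partition function\<close>

lemma bij_betw_vec_nth_PiE:
  "bij_betw vec_nth {x :: 'a ^ 'd::finite. \<forall>i. x $ i \<in> A i} (PiE UNIV A)"
  by (rule bij_betw_byWitness[where f' = vec_lambda]) (auto simp: vec_lambda_inverse)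

lemma sum_vec_prod:
  fixes g :: "'d::finite \<Rightarrow> 'a \<Rightarrow> 'b::comm_semiring_1"
  assumes "\<And>i. finite (A i)"
  shows "(\<Sum>x | \<forall>i. (x :: 'a ^ 'd) $ i \<in> A i. \<Prod>i\<in>UNIV. g i (x $ i)) = (\<Prod>i\<in>UNIV. \<Sum>a\<in>A i. g i a)"
  using sum.reindex_bij_betw[OF bij_betw_vec_nth_PiE[of A], of "\<lambda>h. \<Prod>i\<in>UNIV. g i (h i)"] assms
  by (simp add: prod_sum_PiE)

lemma card_vec_Pi:
  assumes "\<And>i. finite (A i)"
  shows "card {x :: 'a ^ 'd::finite. \<forall>i. x $ i \<in> A i} = (\<Prod>i\<in>UNIV. card (A i))"
  using bij_betw_same_card[OF bij_betw_vec_nth_PiE[of A]] assms by (simp add: card_PiE)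

lemma card_lattice_box: "card (lattice_box N :: (real ^ 'd::finite) set) = N ^ CARD('d)"
  by (simp add: lattice_box_def card_vec_Pi card_image)

lemma lattice_box_nth:
  assumes "x \<in> lattice_box N"
  obtains a where "x $ i = real a" "1 \<le> a" "a \<le> N"
proof -
  have "x $ i \<in> real ` {1..N}" using assms by (simp add: lattice_box_def)
  then show thesis using that by auto
qed

lemma lattice_box_norm_diff:
  fixes x y :: "real ^ 'd::finite"
  assumes "x \<in> lattice_box N" "y \<in> lattice_box N"
  shows "norm (x - y) \<le> real CARD('d) * real N"
proof -
  have "\<bar>(x - y) $ i\<bar> \<le> real N" for i
    using lattice_box_nth[OF assms(1), of i] lattice_box_nth[OF assms(2), of i]
    by (smt (verit, best) of_nat_0_le_iff of_nat_mono vector_minus_component)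
  then have "(\<Sum>i\<in>UNIV. \<bar>(x - y) $ i\<bar>) \<le> real CARD('d) * real N"
    by (intro sum_bounded_above) auto
  then show ?thesis using norm_le_l1_cart[of "x - y"] by linarith
qed

lemma partition_fun_eq_permanent:
  "partition_fun TYPE('d::finite) N \<beta> =
    permanent (lattice_box N :: (real ^ 'd) set) (\<lambda>x y. exp (- \<beta> * norm (x - y)))"
  by (simp add: partition_fun_def permanent_def perms_def energy_def sum_distrib_left exp_sum sum_negf[symmetric])

lemma ln_partition_fun_ge_tangent:
  assumes "1 \<le> N"
  shows "ln (partition_fun TYPE('d::finite) N \<beta>) - (\<gamma> - \<beta>) * (real N ^ CARD('d) * mean_displacement TYPE('d) N \<beta>)
    \<le> ln (partition_fun TYPE('d) N \<gamma>)"
proof -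
  define P where "P = (perms N :: (real ^ 'd \<Rightarrow> real ^ 'd) set)"
  define Z where "Z = partition_fun TYPE('d) N \<beta>"
  define w where "w \<pi> = exp (- \<beta> * energy N \<pi>)" for \<pi> :: "real ^ 'd \<Rightarrow> real ^ 'd"
  define E where "E = real N ^ CARD('d) * mean_displacement TYPE('d) N \<beta>"
  define \<mu> where "\<mu> = - (\<gamma> - \<beta>) * E"
  have Z: "Z > 0" by (simp add: Z_def partition_fun_pos)
  have sw: "(\<Sum>\<pi>\<in>P. w \<pi>) = Z" by (simp add: Z_def P_def w_def partition_fun_def)
  have "E = (\<Sum>\<pi>\<in>P. w \<pi> / Z * energy N \<pi>)"
    using assms by (simp add: E_def mean_displacement_eq_energy integral_gibbs P_def w_def Z_def)
  then have sE: "(\<Sum>\<pi>\<in>P. w \<pi> * energy N \<pi>) = Z * E"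
    using Z by (simp add: sum_divide_distrib[symmetric] field_simps)
  have "exp \<mu> * Z = exp \<mu> * (\<Sum>\<pi>\<in>P. w \<pi> * (1 + (- (\<gamma> - \<beta>) * energy N \<pi> - \<mu>)))"
  proof -
    have "(\<Sum>\<pi>\<in>P. w \<pi> * (1 + (- (\<gamma> - \<beta>) * energy N \<pi> - \<mu>)))
        = (1 - \<mu>) * (\<Sum>\<pi>\<in>P. w \<pi>) - (\<gamma> - \<beta>) * (\<Sum>\<pi>\<in>P. w \<pi> * energy N \<pi>)"
      by (simp add: sum_distrib_left sum_subtractf[symmetric] algebra_simps)
    also have "\<dots> = Z" unfolding sw sE \<mu>_def by (simp add: algebra_simps)
    finally show ?thesis by simp
  qed
  also have "\<dots> \<le> exp \<mu> * (\<Sum>\<pi>\<in>P. w \<pi> * exp (- (\<gamma> - \<beta>) * energy N \<pi> - \<mu>))"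
    by (intro mult_left_mono sum_mono exp_ge_add_one_self) (auto simp: w_def)
  also have "\<dots> = partition_fun TYPE('d) N \<gamma>"
    by (simp add: sum_distrib_left partition_fun_def P_def w_def exp_add[symmetric] algebra_simps)
  finally have "ln (exp \<mu> * Z) \<le> ln (partition_fun TYPE('d) N \<gamma>)"
    using Z by (subst ln_le_cancel_iff) (auto simp: partition_fun_pos)
  then have "\<mu> + ln Z \<le> ln (partition_fun TYPE('d) N \<gamma>)" using Z by (simp add: ln_mult)
  then show ?thesis by (simp add: Z_def \<mu>_def E_def algebra_simps)
qed

lemma mean_displacement_antimono:
  assumes "1 \<le> N" "\<beta> \<le> \<gamma>"
  shows "mean_displacement TYPE('d::finite) N \<gamma> \<le> mean_displacement TYPE('d) N \<beta>"
proof (cases "\<beta> = \<gamma>")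
  case False
  let ?n = "real N ^ CARD('d)"
  have "(\<gamma> - \<beta>) * (?n * mean_displacement TYPE('d) N \<gamma>) \<le> (\<gamma> - \<beta>) * (?n * mean_displacement TYPE('d) N \<beta>)"
    using ln_partition_fun_ge_tangent[OF assms(1), of \<beta> \<gamma>, where 'd='d]
      ln_partition_fun_ge_tangent[OF assms(1), of \<gamma> \<beta>, where 'd='d] by (simp add: algebra_simps)
  then show ?thesis using False assms by (simp add: mult_le_cancel_left)
qed simp

lemma mean_displacement_bounds:
  assumes "1 \<le> N"
  shows "0 \<le> mean_displacement TYPE('d::finite) N \<beta>"
    and "mean_displacement TYPE('d) N \<beta> \<le> real CARD('d) * real N"
proof -
  let ?B = "lattice_box N :: (real ^ 'd) set"
  let ?I = "\<lambda>x :: real ^ 'd. \<integral>\<pi>. norm (x - \<pi> x) \<partial>(gibbs N \<beta> :: (real ^ 'd \<Rightarrow> real ^ 'd) measure)"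
  let ?Z = "partition_fun TYPE('d) N \<beta>"
  have Z: "?Z > 0" by (rule partition_fun_pos)
  show "0 \<le> mean_displacement TYPE('d) N \<beta>"
    by (auto simp: mean_displacement_def intro!: divide_nonneg_nonneg sum_nonneg)
  have "?I x \<le> real CARD('d) * real N" if "x \<in> ?B" for x
  proof -
    have "?I x \<le> (\<Sum>\<pi>\<in>perms N. exp (- \<beta> * energy N (\<pi> :: real ^ 'd \<Rightarrow> real ^ 'd)) / ?Z * (real CARD('d) * real N))"
      unfolding integral_gibbs using Z that
      by (intro sum_mono mult_left_mono lattice_box_norm_diff) (auto simp: perms_def permutes_in_image)
    also have "\<dots> = real CARD('d) * real N"
      using Z by (simp add: sum_distrib_right[symmetric] sum_divide_distrib[symmetric] partition_fun_def)
    finally show ?thesis .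
  qed
  then have "(\<Sum>x\<in>?B. ?I x) \<le> real (card ?B) * (real CARD('d) * real N)"
    by (rule sum_bounded_above)
  then show "mean_displacement TYPE('d) N \<beta> \<le> real CARD('d) * real N"
    using assms by (simp add: mean_displacement_def card_lattice_box field_simps)
qed

lemma sum_exp_dist_le:
  fixes t :: real and k N :: nat
  assumes t: "0 < t" "t \<le> 1"
  shows "(\<Sum>a\<in>real ` {1..N}. exp (- t * \<bar>real k - a\<bar>)) \<le> 4 / t"
proof -
  define h where "h j = exp (- t * \<bar>real k - real j\<bar>)" for j :: nat
  define r where "r = exp (- t)"
  have r: "0 < r" "r < 1" using t by (auto simp: r_def)
  have r1: "1 / (1 - r) \<le> 2 / t"
  proof -
    have "1 + t \<le> exp t" by (rule exp_ge_add_one_self)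
    then have "r \<le> 1 / (1 + t)" using t unfolding r_def exp_minus by (simp add: field_simps)
    then have "t / (1 + t) \<le> 1 - r" using t by (simp add: field_simps)
    moreover have "t / 2 \<le> t / (1 + t)" using t by (intro divide_left_mono) auto
    ultimately have "t / 2 \<le> 1 - r" by linarith
    then show ?thesis using t r by (simp add: field_simps)
  qed
  have geo: "(\<Sum>i\<le>n. r ^ i) \<le> 2 / t" for n :: nat
  proof -
    have "(\<Sum>i\<le>n. r ^ i) \<le> (\<Sum>i. r ^ i)" using r by (intro sum_le_suminf summable_geometric) auto
    also have "\<dots> = 1 / (1 - r)" using r by (intro suminf_geometric) auto
    finally show ?thesis using r1 by linarith
  qed
  let ?A = "(\<lambda>i. k - i) ` {..k}" and ?B = "(\<lambda>i. k + i) ` {..N}"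
  have "{1..N} \<subseteq> ?A \<union> ?B"
  proof
    fix j assume "j \<in> {1..N}"
    then show "j \<in> ?A \<union> ?B"
      by (cases "j \<le> k") (auto intro: image_eqI[of _ _ "k - j"] image_eqI[of _ _ "j - k"])
  qed
  then have "sum h {1..N} \<le> sum h (?A \<union> ?B)" by (intro sum_mono2) (auto simp: h_def)
  also have "\<dots> \<le> sum h ?A + sum h ?B"
    using sum.union_inter[of ?A ?B h] sum_nonneg[of "?A \<inter> ?B" h] by (simp add: h_def)
  also have "sum h ?A = (\<Sum>i\<le>k. r ^ i)"
    by (subst sum.reindex) (auto simp: inj_on_def h_def r_def exp_of_nat_mult[symmetric] of_nat_diff mult.commute)
  also have "sum h ?B = (\<Sum>i\<le>N. r ^ i)"
    by (subst sum.reindex) (auto simp: inj_on_def h_def r_def exp_of_nat_mult[symmetric] mult.commute)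
  finally have "sum h {1..N} \<le> 4 / t" using geo[of k] geo[of N] by simp
  then show ?thesis by (simp add: sum.reindex h_def)
qed

lemma ln_partition_fun_upper:
  fixes \<beta> :: real
  assumes \<beta>: "0 < \<beta>" "\<beta> \<le> 1"
  shows "ln (partition_fun TYPE('d::finite) N \<beta>) \<le>
    real (N ^ CARD('d)) * (real CARD('d) * ln (4 * real CARD('d) / \<beta>))"
proof -
  let ?B = "lattice_box N :: (real ^ 'd) set"
  let ?d = "real CARD('d)"
  have d: "?d \<ge> 1" by (simp add: Suc_leI)
  have bd: "\<beta> / ?d \<le> 1" using \<beta> d by (subst pos_divide_le_eq) linarith+
  have row: "(\<Sum>y\<in>?B. exp (- \<beta> * norm (x - y))) \<le> (4 * ?d / \<beta>) ^ CARD('d)" if x: "x \<in> ?B" for x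
  proof -
    have "exp (- \<beta> * norm (x - y)) \<le> (\<Prod>i\<in>UNIV. exp (- (\<beta> / ?d) * \<bar>x $ i - y $ i\<bar>))" for y
    proof -
      have "(\<Sum>i\<in>UNIV. \<bar>(x - y) $ i\<bar>) \<le> ?d * norm (x - y)"
        by (intro sum_bounded_above component_le_norm_cart)
      then have "(\<beta> / ?d) * (\<Sum>i\<in>UNIV. \<bar>(x - y) $ i\<bar>) \<le> (\<beta> / ?d) * (?d * norm (x - y))"
        using \<beta> by (intro mult_left_mono) auto
      then have "- \<beta> * norm (x - y) \<le> (\<Sum>i\<in>UNIV. - (\<beta> / ?d) * \<bar>x $ i - y $ i\<bar>)"
        by (simp add: sum_negf sum_distrib_left)
      then have "exp (- \<beta> * norm (x - y)) \<le> exp (\<Sum>i\<in>UNIV. - (\<beta> / ?d) * \<bar>x $ i - y $ i\<bar>)"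
        by simp
      then show ?thesis by (simp add: exp_sum)
    qed
    then have "(\<Sum>y\<in>?B. exp (- \<beta> * norm (x - y)))
        \<le> (\<Sum>y\<in>?B. \<Prod>i\<in>UNIV. exp (- (\<beta> / ?d) * \<bar>x $ i - y $ i\<bar>))"
      by (intro sum_mono)
    also have "\<dots> = (\<Prod>i\<in>UNIV. \<Sum>a\<in>real ` {1..N}. exp (- (\<beta> / ?d) * \<bar>x $ i - a\<bar>))"
      unfolding lattice_box_def by (rule sum_vec_prod) simp
    also have "\<dots> \<le> (\<Prod>i\<in>(UNIV :: 'd set). 4 / (\<beta> / ?d))"
    proof (intro prod_mono conjI sum_nonneg)
      fix i :: 'd
      obtain a where "x $ i = real a" using lattice_box_nth[OF x, of i] by auto
      then show "(\<Sum>a\<in>real ` {1..N}. exp (- (\<beta> / ?d) * \<bar>x $ i - a\<bar>)) \<le> 4 / (\<beta> / ?d)"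
        using \<beta> sum_exp_dist_le[of "\<beta> / ?d" a N] bd by simp
    qed auto
    finally show ?thesis by (simp add: mult.commute)
  qed
  have "partition_fun TYPE('d) N \<beta> \<le> (\<Prod>x\<in>?B. \<Sum>y\<in>?B. exp (- \<beta> * norm (x - y)))"
    unfolding partition_fun_eq_permanent by (intro permanent_le_prod_row_sums) auto
  also have "\<dots> \<le> (\<Prod>x\<in>?B. (4 * ?d / \<beta>) ^ CARD('d))"
    by (intro prod_mono conjI row sum_nonneg) auto
  also have "\<dots> = ((4 * ?d / \<beta>) ^ CARD('d)) ^ (N ^ CARD('d))"
    by (simp add: card_lattice_box)
  finally have "ln (partition_fun TYPE('d) N \<beta>) \<le> ln (((4 * ?d / \<beta>) ^ CARD('d)) ^ (N ^ CARD('d)))"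
    using \<beta> d by (subst ln_le_cancel_iff) (auto simp: partition_fun_pos intro!: divide_pos_pos)
  then show ?thesis using \<beta> d by (simp add: ln_realpow)
qed

lemma fact_ge_div_exp_power: "(real k / exp 1) ^ k \<le> fact k"
proof -
  have s: "summable (\<lambda>n. real k ^ n /\<^sub>R fact n)" by (rule summable_exp_generic)
  have "(\<Sum>n\<in>{k}. real k ^ n /\<^sub>R fact n) \<le> exp (real k)"
    unfolding exp_def by (intro sum_le_suminf s) auto
  then have "real k ^ k \<le> fact k * exp 1 ^ k"
    by (simp add: divide_simps mult.commute flip: exp_of_nat_mult)
  then show ?thesis by (simp add: power_divide divide_simps)
qed

lemma permanent_ge_block_diagonal:
  assumes S: "finite S" and I: "finite I" and bI: "b ` S \<subseteq> I"
    and m: "0 \<le> m" "\<And>i. i \<in> I \<Longrightarrow> m \<le> real (card {x\<in>S. b x = i})"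
    and nn: "\<And>x y. x \<in> S \<Longrightarrow> y \<in> S \<Longrightarrow> 0 \<le> K x y"
    and t: "0 \<le> t" "\<And>x y. x \<in> S \<Longrightarrow> y \<in> S \<Longrightarrow> b x = b y \<Longrightarrow> t \<le> K x y"
  shows "(t * (m / exp 1)) ^ card S \<le> permanent S K"
proof -
  let ?Q = "{\<pi>. \<pi> permutes S \<and> (\<forall>x\<in>S. b (\<pi> x) = b x)}"
  have "card S = (\<Sum>i\<in>I. card {x\<in>S. b x = i})"
    using sum.group[OF S I bI, of "\<lambda>_. 1 :: nat"] by simp
  then have "(m / exp 1) ^ card S = (\<Prod>i\<in>I. (m / exp 1) ^ card {x\<in>S. b x = i})"
    by (simp add: power_sum)
  also have "\<dots> \<le> (\<Prod>i\<in>I. fact (card {x\<in>S. b x = i}))"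
  proof (intro prod_mono conjI)
    fix i assume i: "i \<in> I"
    have "(m / exp 1) ^ card {x\<in>S. b x = i} \<le> (real (card {x\<in>S. b x = i}) / exp 1) ^ card {x\<in>S. b x = i}"
      using m(1) m(2)[OF i] by (intro power_mono divide_right_mono) auto
    then show "(m / exp 1) ^ card {x\<in>S. b x = i} \<le> fact (card {x\<in>S. b x = i})"
      using fact_ge_div_exp_power order_trans by blast
  qed (use m in auto)
  also have "\<dots> = real (card ?Q)"
    by (subst card_permutes_fibers[OF S I bI bI]) auto
  finally have "t ^ card S * (m / exp 1) ^ card S \<le> t ^ card S * real (card ?Q)"
    using t by (intro mult_left_mono) auto
  also have "\<dots> = (\<Sum>\<pi>\<in>?Q. \<Prod>x\<in>S. t)" by simp
  also have "\<dots> \<le> (\<Sum>\<pi>\<in>?Q. \<Prod>x\<in>S. K x (\<pi> x))"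
    using t by (intro sum_mono prod_mono) (auto simp: permutes_in_image)
  also have "\<dots> \<le> permanent S K"
    unfolding permanent_def using S nn
    by (intro sum_mono2 prod_nonneg) (auto simp: permutes_in_image finite_permutations)
  finally show ?thesis by (simp add: power_mult_distrib power_divide)
qed

text \<open>The last block absorbs the remainder, so every block has length between \<open>l\<close> and \<open>2 * l\<close>.\<close>

definition block_index :: "nat \<Rightarrow> nat \<Rightarrow> nat \<Rightarrow> nat" where
  "block_index N l a = min ((a - 1) div l) (N div l - 1)"

lemma card_block_index_ge:
  assumes "0 < l" "j < N div l"
  shows "l \<le> card {a\<in>{1..N}. block_index N l a = j}"
proof -
  have "{j * l + 1..j * l + l} \<subseteq> {a\<in>{1..N}. block_index N l a = j}"
  proof
    fix a assume a: "a \<in> {j * l + 1..j * l + l}"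
    then have "(a - 1) div l = j" using assms by (intro div_nat_eqI) (auto simp: mult.commute)
    moreover have "j * l + l \<le> N"
      using assms by (metis Suc_leI add.commute div_times_less_eq_dividend le_trans mult_Suc mult_le_mono1)
    ultimately show "a \<in> {a\<in>{1..N}. block_index N l a = j}"
      using a assms by (auto simp: block_index_def)
  qed
  then have "card {j * l + 1..j * l + l} \<le> card {a\<in>{1..N}. block_index N l a = j}"
    by (intro card_mono) auto
  then show ?thesis by simp
qed

lemma block_index_eq_imp_close:
  assumes l: "0 < l" "l \<le> N" and ab: "a \<in> {1..N}" "b \<in> {1..N}" "block_index N l a = block_index N l b"
  shows "\<bar>real a - real b\<bar> \<le> 2 * real l"
proof -
  define j where "j = block_index N l a"
  have q: "1 \<le> N div l" using l by (simp add: Suc_leI div_greater_zero_iff)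
  have "j * l \<le> c - 1 \<and> c - 1 < j * l + 2 * l" if c: "c \<in> {1..N}" "block_index N l c = j" for c
  proof -
    have "(c - 1) div l \<le> N div l" using c by (intro div_le_mono) auto
    then have "(c - 1) div l = j \<or> (c - 1) div l = Suc j"
      using c(2) q unfolding block_index_def by linarith
    moreover obtain e r where er: "c - 1 = e * l + r" "r < l" "(c - 1) div l = e"
      using l by (metis div_mult_mod_eq mod_less_divisor)
    ultimately show ?thesis unfolding er by (elim disjE) auto
  qed
  from this[of a] this[of b] ab show ?thesis unfolding j_def by fastforce
qed

lemma ln_partition_fun_lower:
  fixes \<beta> :: real
  assumes N: "1 \<le> N" and \<beta>: "1 / real N \<le> \<beta>" "\<beta> \<le> 1"
  shows "real (N ^ CARD('d)) * (- real CARD('d) * ln (2 * \<beta>) - 1 - 2 * real CARD('d))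
    \<le> ln (partition_fun TYPE('d::finite) N \<beta>)"
proof -
  let ?B = "lattice_box N :: (real ^ 'd) set"
  let ?d = "real CARD('d)"
  have \<beta>0: "0 < \<beta>" using N \<beta>(1) by (smt (verit) divide_pos_pos of_nat_1 of_nat_mono)
  define l where "l = nat \<lfloor>1 / \<beta>\<rfloor>"
  have l_le: "real l \<le> 1 / \<beta>" using \<beta>0 by (simp add: l_def)
  have ge1: "1 \<le> 1 / \<beta>" using \<beta> \<beta>0 by simp
  then have l0: "0 < l" by (simp add: l_def)
  have l_ge: "1 / (2 * \<beta>) \<le> real l"
  proof -
    have "1 / \<beta> < real l + 1" unfolding l_def using \<beta>0 by (simp add: floor_less_iff)
    moreover have "1 \<le> real l" using l0 by simp
    moreover have "1 / (2 * \<beta>) = 1 / \<beta> / 2" by simp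
    ultimately show ?thesis by linarith
  qed
  have "1 / \<beta> \<le> real N" using N \<beta>(1) \<beta>0 by (simp add: field_simps)
  then have lN: "l \<le> N" using l_le by linarith
  define b where "b x i = block_index N l (nat \<lfloor>x $ i\<rfloor>)" for x :: "real ^ 'd" and i
  let ?I = "PiE UNIV (\<lambda>_. {..<N div l}) :: ('d \<Rightarrow> nat) set"
  have q: "0 < N div l" using l0 lN by (simp add: div_greater_zero_iff)
  have "(exp (- 2 * ?d) * ((1 / (2 * \<beta>)) ^ CARD('d) / exp 1)) ^ card ?B \<le> partition_fun TYPE('d) N \<beta>"
    unfolding partition_fun_eq_permanent
  proof (rule permanent_ge_block_diagonal[where b = b and I = ?I])
    show "finite ?I" by (intro finite_PiE) auto
    show "b ` ?B \<subseteq> ?I" using q by (auto simp: b_def block_index_def)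
    show "(1 / (2 * \<beta>)) ^ CARD('d) \<le> real (card {x \<in> ?B. b x = j})" if j: "j \<in> ?I" for j
    proof -
      have "{x \<in> ?B. b x = j} = {x. \<forall>i. x $ i \<in> real ` {a\<in>{1..N}. block_index N l a = j i}}"
      proof -
        have "r \<in> real ` {a\<in>{1..N}. block_index N l a = k}
            \<longleftrightarrow> r \<in> real ` {1..N} \<and> block_index N l (nat \<lfloor>r\<rfloor>) = k" for r k
          by auto
        then show ?thesis by (auto simp: lattice_box_def b_def fun_eq_iff)
      qed
      then have "real (card {x \<in> ?B. b x = j}) =
          (\<Prod>i\<in>UNIV. real (card {a\<in>{1..N}. block_index N l a = j i}))"
        by (simp add: card_vec_Pi card_image)
      moreover have "(\<Prod>i\<in>(UNIV :: 'd set). real l) \<le> \<dots>"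
        using j l0 by (intro prod_mono conjI of_nat_mono card_block_index_ge) auto
      moreover have "(1 / (2 * \<beta>)) ^ CARD('d) \<le> real l ^ CARD('d)"
        using l_ge \<beta>0 by (intro power_mono) auto
      ultimately show ?thesis by simp
    qed
    show "exp (- 2 * ?d) \<le> exp (- \<beta> * norm (x - y))" if xy: "x \<in> ?B" "y \<in> ?B" "b x = b y" for x y
    proof -
      have "\<bar>(x - y) $ i\<bar> \<le> 2 * real l" for i
      proof -
        obtain a where a: "x $ i = real a" "1 \<le> a" "a \<le> N" by (rule lattice_box_nth[OF xy(1)])
        obtain c where c: "y $ i = real c" "1 \<le> c" "c \<le> N" by (rule lattice_box_nth[OF xy(2)])
        have "block_index N l a = block_index N l c" using fun_cong[OF xy(3), of i] a c by (simp add: b_def)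
        then show ?thesis using block_index_eq_imp_close[OF l0 lN, of a c] a c by simp
      qed
      then have "(\<Sum>i\<in>UNIV. \<bar>(x - y) $ i\<bar>) \<le> ?d * (2 * real l)"
        by (intro sum_bounded_above)
      then have "norm (x - y) \<le> ?d * (2 * real l)"
        using norm_le_l1_cart[of "x - y"] by linarith
      then have "\<beta> * norm (x - y) \<le> \<beta> * (?d * (2 * (1 / \<beta>)))"
        using l_le \<beta>0 by (smt (verit) mult_left_mono of_nat_0_le_iff)
      then show ?thesis using \<beta>0 by simp
    qed
  qed (use \<beta>0 in auto)
  then have "ln ((exp (- 2 * ?d) * ((1 / (2 * \<beta>)) ^ CARD('d) / exp 1)) ^ card ?B)
      \<le> ln (partition_fun TYPE('d) N \<beta>)"
    using \<beta>0 by (subst ln_le_cancel_iff) (auto simp: partition_fun_pos)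
  then show ?thesis using \<beta>0
    by (simp add: card_lattice_box ln_realpow ln_mult ln_div algebra_simps)
qed

lemma mean_displacement_order_inverse:
  obtains K :: real where "1 \<le> K"
    and "\<And>N \<beta>. 1 \<le> N \<Longrightarrow> 1 / real N \<le> \<beta> \<Longrightarrow> K * \<beta> \<le> 1 \<Longrightarrow>
      1 / (K * \<beta>) \<le> mean_displacement TYPE('d::finite) N \<beta> \<and> mean_displacement TYPE('d) N \<beta> \<le> K / \<beta>"
proof -
  let ?D = "mean_displacement TYPE('d)" and ?Z = "partition_fun TYPE('d)"
  let ?d = "real CARD('d)"
  have d: "1 \<le> ?d" by (simp add: Suc_leI)
  define A where "A = 2 * (?d * ln (16 * ?d) + 1 + 2 * ?d)"
  define L where "L = exp (ln (8 * ?d) + 4)"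
  define K where "K = max L A"
  have "0 \<le> ln (8 * ?d)" using d by (intro ln_ge_zero) linarith
  then have L: "1 < L" unfolding L_def one_less_exp_iff by linarith
  show ?thesis
  proof
    show "1 \<le> K" using L by (simp add: K_def)
    fix N :: nat and \<beta> :: real
    assume N: "1 \<le> N" and \<beta>: "1 / real N \<le> \<beta>" "K * \<beta> \<le> 1"
    let ?n = "real (N ^ CARD('d))"
    have n: "?n > 0" using N by simp
    have \<beta>0: "0 < \<beta>" using N \<beta>(1) by (smt (verit) divide_pos_pos of_nat_1 of_nat_mono)
    have L\<beta>: "L * \<beta> \<le> 1" using \<beta> \<beta>0 by (smt (verit) K_def mult_right_mono)
    then have \<beta>1: "\<beta> \<le> 1" using L \<beta>0 by (smt (verit) mult_le_cancel_right1)
    note low = ln_partition_fun_lower[OF N \<beta>(1) \<beta>1, where 'd='d]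
    have "(\<beta> / 2) * (?n * ?D N \<beta>) \<le> ln (?Z N (\<beta> / 2)) - ln (?Z N \<beta>)"
      using ln_partition_fun_ge_tangent[OF N, of \<beta> "\<beta> / 2", where 'd='d] by simp
    also have "\<dots> \<le> ?n * (?d * ln (4 * ?d / (\<beta> / 2))) - ?n * (- ?d * ln (2 * \<beta>) - 1 - 2 * ?d)"
      using \<beta>0 \<beta>1 by (intro diff_mono low ln_partition_fun_upper) auto
    also have "\<dots> = ?n * (?d * (ln (4 * ?d / (\<beta> / 2)) + ln (2 * \<beta>)) + 1 + 2 * ?d)"
      by (simp add: algebra_simps)
    also have "ln (4 * ?d / (\<beta> / 2)) + ln (2 * \<beta>) = ln (16 * ?d)"
      using \<beta>0 d by (subst ln_mult_pos[symmetric]) (auto simp: field_simps)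
    also have "?d * ln (16 * ?d) + 1 + 2 * ?d = A / 2" by (simp add: A_def)
    finally have "?n * (\<beta> / 2 * ?D N \<beta>) \<le> ?n * (A / 2)" by (simp add: mult.left_commute)
    then have "\<beta> * ?D N \<beta> \<le> A" using n by simp
    then have "\<beta> * ?D N \<beta> \<le> K" by (simp add: K_def)
    moreover have "1 \<le> K * \<beta> * ?D N \<beta>"
    proof -
      have "?n * (- ?d * ln (2 * \<beta>) - 1 - 2 * ?d) - ?n * (?d * ln (4 * ?d / (L * \<beta>)))
          \<le> ln (?Z N \<beta>) - ln (?Z N (L * \<beta>))"
        using \<beta>0 L L\<beta> by (intro diff_mono low ln_partition_fun_upper) auto
      also have "\<dots> \<le> (L * \<beta> - \<beta>) * (?n * ?D N \<beta>)"
        using ln_partition_fun_ge_tangent[OF N, of \<beta> "L * \<beta>", where 'd='d] by simp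
      also have "\<dots> \<le> (L * \<beta>) * (?n * ?D N \<beta>)"
        using \<beta>0 n mean_displacement_bounds(1)[OF N, of \<beta>, where 'd='d] by (intro mult_right_mono) auto
      finally have "?n * (- (?d * (ln (2 * \<beta>) + ln (4 * ?d / (L * \<beta>)))) - 1 - 2 * ?d) \<le> ?n * (L * \<beta> * ?D N \<beta>)"
        by (simp add: algebra_simps)
      moreover have "ln (2 * \<beta>) + ln (4 * ?d / (L * \<beta>)) = ln (8 * ?d / L)"
        using \<beta>0 d L by (subst ln_mult_pos[symmetric]) (auto simp: field_simps)
      moreover have "ln (8 * ?d / L) = - 4"
        using d by (subst ln_div) (auto simp: L_def)
      ultimately have "2 * ?d - 1 \<le> L * \<beta> * ?D N \<beta>"
        using n by (simp add: mult_le_cancel_left)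
      then have "1 \<le> L * \<beta> * ?D N \<beta>" using d by linarith
      also have "\<dots> \<le> K * \<beta> * ?D N \<beta>"
        using \<beta>0 mean_displacement_bounds(1)[OF N, of \<beta>, where 'd='d]
        by (intro mult_right_mono) (auto simp: K_def)
      finally show ?thesis .
    qed
    ultimately show "1 / (K * \<beta>) \<le> ?D N \<beta> \<and> ?D N \<beta> \<le> K / \<beta>"
      using \<beta>0 \<open>1 \<le> K\<close> by (simp add: field_simps)
  qed
qed

lemma mean_displacement_inverse_bigtheta:
  assumes pos: "\<forall>N\<ge>1. 0 \<le> \<beta> N" and lo: "(\<lambda>N. 1 / real N) \<in> o(\<beta>)" and hi: "\<beta> \<in> o(\<lambda>_. 1)"
  shows "(\<lambda>N. mean_displacement TYPE('d::finite) N (\<beta> N)) \<in> \<Theta>(\<lambda>N. 1 / \<beta> N)"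
proof -
  obtain K where K: "1 \<le> K"
    and b: "\<And>N \<beta>. 1 \<le> N \<Longrightarrow> 1 / real N \<le> \<beta> \<Longrightarrow> K * \<beta> \<le> 1 \<Longrightarrow>
      1 / (K * \<beta>) \<le> mean_displacement TYPE('d) N \<beta> \<and> mean_displacement TYPE('d) N \<beta> \<le> K / \<beta>"
    by (rule mean_displacement_order_inverse[where 'd='d]) blast
  have "eventually (\<lambda>N. norm (1 / real N) \<le> 1 * norm (\<beta> N)) at_top"
    using lo by (rule landau_o.smallD) simp
  moreover have "eventually (\<lambda>N. norm (\<beta> N) \<le> (1 / K) * norm (1::real)) at_top"
    using hi by (rule landau_o.smallD) (use K in simp)
  ultimately have ev: "eventually (\<lambda>N. 1 \<le> N \<and> 0 < \<beta> N \<and>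
      1 / (K * \<beta> N) \<le> mean_displacement TYPE('d) N (\<beta> N) \<and> mean_displacement TYPE('d) N (\<beta> N) \<le> K / \<beta> N) at_top"
    using eventually_ge_at_top[of "1::nat"]
  proof eventually_elim
    case (elim N)
    have "0 \<le> \<beta> N" using pos elim by simp
    then have "1 / real N \<le> \<beta> N" "K * \<beta> N \<le> 1" using elim K by (auto simp: field_simps)
    moreover have "0 < 1 / real N" using elim by simp
    ultimately show ?case using b[of N "\<beta> N"] elim by linarith
  qed
  show ?thesis
  proof (rule bigthetaI')
    show "eventually (\<lambda>N. 1 / K * norm (1 / \<beta> N) \<le> norm (mean_displacement TYPE('d) N (\<beta> N)) \<and>
        norm (mean_displacement TYPE('d) N (\<beta> N)) \<le> K * norm (1 / \<beta> N)) at_top"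
      using ev
    proof eventually_elim
      case (elim N)
      then show ?case
        using mean_displacement_bounds(1)[of N "\<beta> N", where 'd='d] by simp
    qed
  qed (use K in auto)
qed

lemma mean_displacement_ge_linear:
  fixes c :: real
  obtains \<delta> where "0 < \<delta>"
    "eventually (\<lambda>N. \<delta> * real N \<le> mean_displacement TYPE('d::finite) N (c / real N)) at_top"
proof -
  obtain K where K: "1 \<le> K"
    and b: "\<And>N \<beta>. 1 \<le> N \<Longrightarrow> 1 / real N \<le> \<beta> \<Longrightarrow> K * \<beta> \<le> 1 \<Longrightarrow>
      1 / (K * \<beta>) \<le> mean_displacement TYPE('d) N \<beta> \<and> mean_displacement TYPE('d) N \<beta> \<le> K / \<beta>"
    by (rule mean_displacement_order_inverse[where 'd='d]) blast
  define a where "a = max 1 c"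
  have "eventually (\<lambda>N. K * a \<le> real N) at_top"
    by (rule eventually_compose_filterlim[OF eventually_ge_at_top filterlim_real_sequentially])
  then have "eventually (\<lambda>N. 1 / (K * a) * real N \<le> mean_displacement TYPE('d) N (c / real N)) at_top"
    using eventually_ge_at_top[of "1::nat"]
  proof eventually_elim
    case (elim N)
    have "1 / (K * (a / real N)) \<le> mean_displacement TYPE('d) N (a / real N)"
      using elim b[of N "a / real N"] by (auto simp: field_simps a_def)
    also have "\<dots> \<le> mean_displacement TYPE('d) N (c / real N)"
      using elim by (intro mean_displacement_antimono divide_right_mono) (auto simp: a_def)
    finally show ?case by simp
  qed
  then show ?thesis using K by (intro that[of "1 / (K * a)"]) (auto simp: a_def)
qed

lemma mean_displacement_linear_bigtheta:
  assumes pos: "\<forall>N\<ge>1. 0 \<le> \<beta> N" and O: "\<beta> \<in> O(\<lambda>N. 1 / real N)"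
  shows "(\<lambda>N. mean_displacement TYPE('d::finite) N (\<beta> N)) \<in> \<Theta>(\<lambda>N. real N)"
proof -
  obtain c where c: "eventually (\<lambda>N. norm (\<beta> N) \<le> c * norm (1 / real N)) at_top"
    using O by (elim landau_o.bigE)
  obtain \<delta> where \<delta>: "0 < \<delta>"
    "eventually (\<lambda>N. \<delta> * real N \<le> mean_displacement TYPE('d) N (c / real N)) at_top"
    by (rule mean_displacement_ge_linear)
  have "eventually (\<lambda>N. \<delta> * norm (real N) \<le> norm (mean_displacement TYPE('d) N (\<beta> N)) \<and>
      norm (mean_displacement TYPE('d) N (\<beta> N)) \<le> real CARD('d) * norm (real N)) at_top"
    using c \<delta>(2) eventually_ge_at_top[of "1::nat"]
  proof eventually_elim
    case (elim N)
    have "\<beta> N \<le> c / real N" using elim by simp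
    then have "mean_displacement TYPE('d) N (c / real N) \<le> mean_displacement TYPE('d) N (\<beta> N)"
      using elim by (intro mean_displacement_antimono) auto
    then show ?case
      using elim mean_displacement_bounds[of N "\<beta> N", where 'd='d] by simp
  qed
  then show ?thesis using \<delta>(1) by (intro bigthetaI'[of \<delta> "real CARD('d)"]) auto
qed

section \<open>Permanents of block-constant kernels\<close>

lemma superadditive_convergent:
  fixes u :: "nat \<Rightarrow> real"
  assumes super: "\<And>m n. u m + u n \<le> u (m + n)" and u0: "u 0 = 0"
    and bound: "\<And>n. u n \<le> C * real n"
  shows "convergent (\<lambda>n. u n / real n)"
proof -
  define L where "L = (SUP n\<in>{1..}. u n / real n)"
  have bdd: "bdd_above ((\<lambda>n. u n / real n) ` {1..})"
    using bound by (intro bdd_aboveI[of _ C]) (auto simp: field_simps)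
  have mult: "real q * u m \<le> u (q * m)" for q m
  proof (induction q)
    case (Suc q)
    then show ?case using super[of m "q * m"] by (simp add: algebra_simps)
  qed (simp add: u0)
  have "(\<lambda>n. u n / real n) \<longlonglongrightarrow> L"
  proof (rule order_tendstoI)
    fix a assume "a < L"
    then obtain m where m: "1 \<le> m" "a < u m / real m"
      unfolding L_def by (subst (asm) less_cSUP_iff[OF _ bdd]) auto
    define K where "K = \<bar>u m\<bar> + real m * \<bar>u 1\<bar>"
    have low: "u m / real m - K / real n \<le> u n / real n" if n: "1 \<le> n" for n
    proof -
      define q r where "q = n div m" and "r = n mod m"
      have nqr: "n = q * m + r" and r: "r \<le> m" using m by (auto simp: q_def r_def less_imp_le)
      have "real n * (u m / real m) = real q * u m + real r * (u m / real m)"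
        using m by (simp add: nqr field_simps)
      moreover have "real r * (u m / real m) \<le> \<bar>u m\<bar>"
      proof -
        have "real r * (u m / real m) \<le> real r * (\<bar>u m\<bar> / real m)"
          by (intro mult_left_mono divide_right_mono) auto
        also have "\<dots> \<le> real m * (\<bar>u m\<bar> / real m)"
          using r by (intro mult_right_mono) auto
        finally show ?thesis using m by simp
      qed
      moreover have "real q * u m \<le> u (q * m)" by (rule mult)
      moreover have "u (q * m) \<le> u n - u r" using super[of "q * m" r] nqr by simp
      moreover have "- u r \<le> real m * \<bar>u 1\<bar>"
      proof -
        have "- u r \<le> real r * \<bar>u 1\<bar>" using mult[of r 1] abs_ge_minus_self[of "real r * u 1"]
          by (simp add: abs_mult)
        also have "\<dots> \<le> real m * \<bar>u 1\<bar>" using r by (intro mult_right_mono) auto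
        finally show ?thesis .
      qed
      ultimately have "real n * (u m / real m) - K \<le> u n" unfolding K_def by linarith
      then have "(real n * (u m / real m) - K) / real n \<le> u n / real n" by (rule divide_right_mono) simp
      then show ?thesis using n by (simp add: diff_divide_distrib)
    qed
    have "(\<lambda>n. u m / real m - K / real n) \<longlonglongrightarrow> u m / real m - 0"
      by (intro tendsto_intros lim_const_over_n)
    then have "eventually (\<lambda>n. a < u m / real m - K / real n) sequentially"
      using m by (intro order_tendstoD) auto
    then show "eventually (\<lambda>n. a < u n / real n) sequentially"
      using eventually_ge_at_top[of "1::nat"]
      by eventually_elim (use low less_le_trans in blast)
  next
    fix a assume a: "L < a"
    have "u n / real n < a" if "1 \<le> n" for n
    proof -
      have "u n / real n \<le> L" unfolding L_def using that by (intro cSUP_upper bdd) auto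
      then show ?thesis using a by linarith
    qed
    then show "eventually (\<lambda>n. u n / real n < a) sequentially"
      using eventually_ge_at_top[of "1::nat"] by (rule eventually_mono[rotated])
  qed
  then show ?thesis by (rule convergentI)
qed

definition equifiber_maps :: "'a set \<Rightarrow> 'b set \<Rightarrow> nat \<Rightarrow> ('a \<Rightarrow> 'b) set" where
  "equifiber_maps S I m = {f \<in> S \<rightarrow>\<^sub>E I. \<forall>j\<in>I. card {x\<in>S. f x = j} = m}"

lemma finite_equifiber_maps: "finite S \<Longrightarrow> finite I \<Longrightarrow> finite (equifiber_maps S I m)"
  unfolding equifiber_maps_def by (rule finite_subset[OF _ finite_PiE[of S "\<lambda>_. I"]]) auto

lemma permanent_block_kernel:
  fixes B :: "'b \<Rightarrow> 'b \<Rightarrow> real"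
  assumes S: "finite S" and I: "finite I" and bI: "b ` S \<subseteq> I"
    and m: "\<And>i. i \<in> I \<Longrightarrow> card {x\<in>S. b x = i} = m"
  shows "permanent S (\<lambda>x y. B (b x) (b y)) =
    fact m ^ card I * (\<Sum>f\<in>equifiber_maps S I m. \<Prod>x\<in>S. B (b x) (f x))"
proof -
  let ?P = "{\<pi>. \<pi> permutes S}" and ?r = "\<lambda>\<pi>. restrict (b \<circ> \<pi>) S"
  have sub: "?r ` ?P \<subseteq> equifiber_maps S I m"
  proof (rule image_subsetI)
    fix \<pi> assume "\<pi> \<in> ?P"
    then have \<pi>: "\<pi> permutes S" by simp
    have "card {x\<in>S. ?r \<pi> x = j} = m" if j: "j \<in> I" for j
    proof -
      have "\<pi> ` {x\<in>S. ?r \<pi> x = j} = {x\<in>S. b x = j}"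
      proof safe
        fix x assume "x \<in> S" "j = b x"
        then show "x \<in> \<pi> ` {y\<in>S. ?r \<pi> y = b x}"
          using permutes_in_image[OF permutes_inv[OF \<pi>]] permutes_inverses[OF \<pi>]
          by (intro image_eqI[of _ _ "inv \<pi> x"]) auto
      qed (use permutes_in_image[OF \<pi>] in auto)
      then show ?thesis
        using m[OF j] card_image[OF permutes_inj_on[OF \<pi>], of "{x\<in>S. ?r \<pi> x = j}"] by simp
    qed
    then show "?r \<pi> \<in> equifiber_maps S I m"
      using bI permutes_in_image[OF \<pi>] by (auto simp: equifiber_maps_def)
  qed
  have "permanent S (\<lambda>x y. B (b x) (b y)) = (\<Sum>\<pi>\<in>?P. \<Prod>x\<in>S. B (b x) (?r \<pi> x))"
    by (simp add: permanent_def)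
  also have "\<dots> = (\<Sum>f\<in>equifiber_maps S I m. \<Sum>\<pi> | \<pi> \<in> ?P \<and> ?r \<pi> = f. \<Prod>x\<in>S. B (b x) (?r \<pi> x))"
    by (rule sum.group[OF _ _ sub, symmetric]) (auto simp: S I finite_permutations finite_equifiber_maps)
  also have "\<dots> = (\<Sum>f\<in>equifiber_maps S I m. fact m ^ card I * (\<Prod>x\<in>S. B (b x) (f x)))"
  proof (rule sum.cong[OF refl])
    fix f assume f: "f \<in> equifiber_maps S I m"
    have fI: "f ` S \<subseteq> I" and cf: "\<And>j. j \<in> I \<Longrightarrow> card {x\<in>S. f x = j} = m" and ext: "f \<in> extensional S"
      using f by (auto simp: equifiber_maps_def PiE_iff)
    have "{\<pi>. \<pi> \<in> ?P \<and> ?r \<pi> = f} = {\<pi>. \<pi> permutes S \<and> (\<forall>x\<in>S. b (\<pi> x) = f x)}"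
      using ext by (auto simp: fun_eq_iff restrict_def extensional_def)
    then have "card {\<pi>. \<pi> \<in> ?P \<and> ?r \<pi> = f} = fact m ^ card I"
      using card_permutes_fibers[OF S I fI bI] cf m by simp
    moreover have "(\<Sum>\<pi> | \<pi> \<in> ?P \<and> ?r \<pi> = f. \<Prod>x\<in>S. B (b x) (?r \<pi> x))
        = (\<Sum>\<pi> | \<pi> \<in> ?P \<and> ?r \<pi> = f. \<Prod>x\<in>S. B (b x) (f x))"
      by (rule sum.cong) auto
    ultimately show "(\<Sum>\<pi> | \<pi> \<in> ?P \<and> ?r \<pi> = f. \<Prod>x\<in>S. B (b x) (?r \<pi> x))
        = fact m ^ card I * (\<Prod>x\<in>S. B (b x) (f x))"
      by simp
  qed
  finally show ?thesis by (simp add: sum_distrib_left)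
qed

lemma permanent_reindex:
  assumes h: "bij_betw h S T"
  shows "permanent T K = permanent S (\<lambda>x y. K (h x) (h y))"
proof -
  have "permanent T K = (\<Sum>\<pi> | \<pi> permutes S. \<Prod>x\<in>T. K x (if x \<in> T then h (\<pi> (inv_into S h x)) else x))"
    unfolding permanent_def by (rule sum.reindex_bij_betw[OF bij_betw_permutations[OF h], symmetric])
  also have "\<dots> = (\<Sum>\<pi> | \<pi> permutes S. \<Prod>x\<in>S. K (h x) (h (\<pi> x)))"
  proof (rule sum.cong[OF refl])
    fix \<pi>
    show "(\<Prod>x\<in>T. K x (if x \<in> T then h (\<pi> (inv_into S h x)) else x)) = (\<Prod>x\<in>S. K (h x) (h (\<pi> x)))"
      using bij_betw_inv_into_left[OF h] bij_betwE[OF h]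
      by (subst prod.reindex_bij_betw[OF h, symmetric]) (auto intro!: prod.cong)
  qed
  finally show ?thesis by (simp add: permanent_def)
qed

lemma equal_fibers_trivialize:
  assumes S: "finite S" and bI: "b ` S \<subseteq> I"
    and m: "\<And>i. i \<in> I \<Longrightarrow> card {x\<in>S. b x = i} = m"
  obtains h where "bij_betw h S (I \<times> {..<m})" "\<And>x. x \<in> S \<Longrightarrow> fst (h x) = b x"
proof -
  have "\<exists>g. bij_betw g {x\<in>S. b x = i} {..<m}" if "i \<in> I" for i
    using m[OF that] S by (intro finite_same_card_bij) auto
  then obtain g where g: "\<And>i. i \<in> I \<Longrightarrow> bij_betw (g i) {x\<in>S. b x = i} {..<m}" by metis
  define h where "h x = (b x, g (b x) x)" for x
  have "bij_betw h S (I \<times> {..<m})"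
  proof (rule bij_betw_imageI)
    show "inj_on h S"
    proof (rule inj_onI)
      fix x y assume xy: "x \<in> S" "y \<in> S" "h x = h y"
      then have "b x = b y" "g (b x) x = g (b x) y" by (auto simp: h_def)
      moreover have "inj_on (g (b x)) {z\<in>S. b z = b x}" using g[of "b x"] bI xy by (auto simp: bij_betw_def)
      ultimately show "x = y" using xy by (auto simp: inj_on_def)
    qed
    have "b x \<in> I \<and> g (b x) x \<in> {..<m}" if "x \<in> S" for x
      using that bI g[of "b x"] by (auto simp: bij_betw_def)
    moreover have "(i, k) \<in> h ` S" if ik: "i \<in> I" "k < m" for i k
    proof -
      have "k \<in> g i ` {x\<in>S. b x = i}" using ik g[of i] by (auto simp: bij_betw_def)
      then show ?thesis by (auto simp: h_def)
    qed
    ultimately show "h ` S = I \<times> {..<m}" by (auto simp: h_def)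
  qed
  then show ?thesis by (rule that) (simp add: h_def)
qed

definition block_sum :: "'b set \<Rightarrow> ('b \<Rightarrow> 'b \<Rightarrow> real) \<Rightarrow> nat \<Rightarrow> real" where
  "block_sum I B m = (\<Sum>f\<in>equifiber_maps (I \<times> {..<m}) I m. \<Prod>x\<in>I \<times> {..<m}. B (fst x) (f x))"

lemma block_permanent_eq:
  assumes "finite I"
  shows "permanent (I \<times> {..<m}) (\<lambda>x y. B (fst x) (fst y)) = fact m ^ card I * block_sum I B m"
  unfolding block_sum_def
proof (rule permanent_block_kernel)
  fix i assume "i \<in> I"
  then have "{x \<in> I \<times> {..<m}. fst x = i} = Pair i ` {..<m}" by auto
  then show "card {x \<in> I \<times> {..<m}. fst x = i} = m" by (simp add: card_image inj_on_def)
qed (use assms in auto)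

lemma block_sum_supermult:
  assumes I: "finite I" and B: "\<And>i j. i \<in> I \<Longrightarrow> j \<in> I \<Longrightarrow> 0 \<le> B i j"
  shows "block_sum I B m * block_sum I B n \<le> block_sum I B (m + n)"
proof -
  define T where "T k = I \<times> {..<k}" for k :: nat
  define s where "s x = (fst x, snd x + m)" for x :: "'a \<times> nat"
  define s' where "s' x = (fst x, snd x - m)" for x :: "'a \<times> nat"
  have fT: "finite (T k)" for k using I by (simp add: T_def)
  have T: "T (m + n) = T m \<union> s ` T n"
  proof safe
    fix i k assume ik: "(i, k) \<in> T (m + n)" "(i, k) \<notin> s ` T n"
    have "k < m"
    proof (rule ccontr)
      assume "\<not> k < m"
      then have "(i, k) = s (i, k - m)" "(i, k - m) \<in> T n" using ik by (auto simp: s_def T_def)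
      then show False using ik by blast
    qed
    then show "(i, k) \<in> T m" using ik by (simp add: T_def)
  qed (auto simp: T_def s_def)
  have disj: "T m \<inter> s ` T n = {}" by (auto simp: T_def s_def)
  have inj: "inj_on s X" for X by (auto simp: s_def inj_on_def)
  define \<Phi> where "\<Phi> p = (\<lambda>x\<in>T (m + n). if snd x < m then fst p x else snd p (s' x))"
    for p :: "('a \<times> nat \<Rightarrow> 'a) \<times> ('a \<times> nat \<Rightarrow> 'a)"
  have \<Phi>1: "\<Phi> p x = fst p x" if "x \<in> T m" for p x using that by (auto simp: \<Phi>_def T_def)
  have \<Phi>2: "\<Phi> p (s x) = snd p x" if "x \<in> T n" for p x
    using that by (auto simp: \<Phi>_def T_def s_def s'_def)
  let ?A = "equifiber_maps (T m) I m \<times> equifiber_maps (T n) I n"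
  have mem: "\<Phi> p \<in> equifiber_maps (T (m + n)) I (m + n)" if p: "p \<in> ?A" for p
  proof -
    have f: "fst p \<in> T m \<rightarrow>\<^sub>E I" "\<And>j. j \<in> I \<Longrightarrow> card {x\<in>T m. fst p x = j} = m"
      and g: "snd p \<in> T n \<rightarrow>\<^sub>E I" "\<And>j. j \<in> I \<Longrightarrow> card {x\<in>T n. snd p x = j} = n"
      using p by (auto simp: equifiber_maps_def)
    have "\<Phi> p x \<in> I" if "x \<in> T (m + n)" for x
      using that unfolding T
    proof
      assume "x \<in> T m"
      then show ?thesis using f(1) \<Phi>1 by (metis PiE_mem)
    next
      assume "x \<in> s ` T n"
      then show ?thesis using g(1) \<Phi>2 by (metis PiE_mem imageE)
    qed
    moreover have "\<Phi> p \<in> extensional (T (m + n))" by (simp add: \<Phi>_def)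
    moreover have "card {x\<in>T (m + n). \<Phi> p x = j} = m + n" if j: "j \<in> I" for j
    proof -
      have "{x\<in>T (m + n). \<Phi> p x = j} = {x\<in>T m. fst p x = j} \<union> s ` {x\<in>T n. snd p x = j}"
        unfolding T using \<Phi>1[of _ p] \<Phi>2[of _ p] by auto
      moreover have "card \<dots> = card {x\<in>T m. fst p x = j} + card (s ` {x\<in>T n. snd p x = j})"
        using fT disj by (intro card_Un_disjoint) auto
      ultimately show ?thesis using f(2)[OF j] g(2)[OF j] by (simp add: card_image[OF inj])
    qed
    ultimately show ?thesis by (auto simp: equifiber_maps_def PiE_iff)
  qed
  have inj\<Phi>: "inj_on \<Phi> ?A"
  proof (rule inj_onI)
    fix p p' assume p: "p \<in> ?A" "p' \<in> ?A" "\<Phi> p = \<Phi> p'"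
    have "fst p = fst p'"
      by (rule PiE_ext[of _ "T m" "\<lambda>_. I"]) (use p \<Phi>1 in \<open>auto simp: equifiber_maps_def, metis\<close>)
    moreover have "snd p = snd p'"
      by (rule PiE_ext[of _ "T n" "\<lambda>_. I"]) (use p \<Phi>2 in \<open>auto simp: equifiber_maps_def, metis\<close>)
    ultimately show "p = p'" by (rule prod_eqI)
  qed
  have nn: "0 \<le> (\<Prod>x\<in>T (m + n). B (fst x) (f x))" if "f \<in> equifiber_maps (T (m + n)) I (m + n)" for f
  proof (intro prod_nonneg)
    fix x assume "x \<in> T (m + n)"
    then have "fst x \<in> I" "f x \<in> I" using that by (auto simp: equifiber_maps_def T_def)
    then show "0 \<le> B (fst x) (f x)" by (rule B)
  qed
  have "block_sum I B m * block_sum I B n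
      = (\<Sum>p\<in>?A. (\<Prod>x\<in>T m. B (fst x) (fst p x)) * (\<Prod>x\<in>T n. B (fst x) (snd p x)))"
    unfolding block_sum_def T_def[symmetric] by (simp add: sum_product sum.cartesian_product split_def)
  also have "\<dots> = (\<Sum>p\<in>?A. \<Prod>x\<in>T (m + n). B (fst x) (\<Phi> p x))"
  proof (rule sum.cong[OF refl])
    fix p
    have "(\<Prod>x\<in>T (m + n). B (fst x) (\<Phi> p x))
        = (\<Prod>x\<in>T m. B (fst x) (\<Phi> p x)) * (\<Prod>x\<in>s ` T n. B (fst x) (\<Phi> p x))"
      unfolding T using fT disj by (intro prod.union_disjoint) auto
    also have "(\<Prod>x\<in>s ` T n. B (fst x) (\<Phi> p x)) = (\<Prod>x\<in>T n. B (fst x) (snd p x))"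
      by (subst prod.reindex[OF inj]) (auto simp: \<Phi>2 s_def[of "(_, _)"] intro!: prod.cong)
    finally show "(\<Prod>x\<in>T m. B (fst x) (fst p x)) * (\<Prod>x\<in>T n. B (fst x) (snd p x))
        = (\<Prod>x\<in>T (m + n). B (fst x) (\<Phi> p x))"
      using \<Phi>1[of _ p] by (simp cong: prod.cong)
  qed
  also have "\<dots> = (\<Sum>f\<in>\<Phi> ` ?A. \<Prod>x\<in>T (m + n). B (fst x) (f x))"
    by (simp add: sum.reindex[OF inj\<Phi>])
  also have "\<dots> \<le> block_sum I B (m + n)"
    unfolding block_sum_def T_def[symmetric] using mem nn fT I
    by (intro sum_mono2 finite_equifiber_maps) auto
  finally show ?thesis .
qed

lemma block_sum_pos:
  assumes I: "finite I" and B: "\<And>i j. i \<in> I \<Longrightarrow> j \<in> I \<Longrightarrow> 0 < B i j"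
  shows "0 < block_sum I B m"
proof -
  have "0 < permanent (I \<times> {..<m}) (\<lambda>x y. B (fst x) (fst y))"
    using I B by (intro permanent_pos) auto
  then show ?thesis using I by (simp add: block_permanent_eq zero_less_mult_iff)
qed

lemma block_sum_le:
  assumes I: "finite I" and B: "\<And>i j. i \<in> I \<Longrightarrow> j \<in> I \<Longrightarrow> 0 < B i j \<and> B i j \<le> 1"
  shows "block_sum I B m \<le> real (card I) ^ (card I * m)"
proof -
  let ?T = "I \<times> {..<m}"
  have "block_sum I B m \<le> (\<Sum>f\<in>equifiber_maps ?T I m. 1)"
    unfolding block_sum_def
  proof (intro sum_mono prod_le_1)
    fix f x assume "f \<in> equifiber_maps ?T I m" "x \<in> ?T"
    then have "fst x \<in> I" "f x \<in> I" by (auto simp: equifiber_maps_def)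
    from B[OF this] show "0 \<le> B (fst x) (f x) \<and> B (fst x) (f x) \<le> 1" by simp
  qed
  also have "\<dots> \<le> (\<Sum>f\<in>?T \<rightarrow>\<^sub>E I. 1)"
    using I by (intro sum_mono2 finite_PiE) (auto simp: equifiber_maps_def)
  also have "\<dots> = real (card I) ^ (card I * m)"
    using I by (simp add: card_funcsetE)
  finally show ?thesis .
qed

lemma convergent_ln_block_sum:
  assumes I: "finite I" "I \<noteq> {}" and B: "\<And>i j. i \<in> I \<Longrightarrow> j \<in> I \<Longrightarrow> 0 < B i j \<and> B i j \<le> 1"
  shows "convergent (\<lambda>m. ln (block_sum I B m) / real m)"
proof (rule superadditive_convergent)
  have pos: "0 < block_sum I B m" for m by (rule block_sum_pos[OF I(1)]) (use B in blast)
  show "ln (block_sum I B m) + ln (block_sum I B n) \<le> ln (block_sum I B (m + n))" for m n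
  proof -
    have "block_sum I B m * block_sum I B n \<le> block_sum I B (m + n)"
      by (rule block_sum_supermult[OF I(1) less_imp_le]) (use B in blast)
    then have "ln (block_sum I B m * block_sum I B n) \<le> ln (block_sum I B (m + n))"
      using pos[of m] pos[of n] pos[of "m + n"] by (subst ln_le_cancel_iff) auto
    then show ?thesis using pos[of m] pos[of n] by (simp add: ln_mult)
  qed
  have "equifiber_maps ({} :: ('a \<times> nat) set) I 0 = {\<lambda>_. undefined}" by (auto simp: equifiber_maps_def)
  then show "ln (block_sum I B 0) = 0" by (simp add: block_sum_def)
  show "ln (block_sum I B n) \<le> (real (card I) * ln (real (card I))) * real n" for n
  proof -
    have c: "0 < real (card I)" using I by (simp add: card_gt_0_iff)
    have "block_sum I B n \<le> real (card I) ^ (card I * n)" by (rule block_sum_le[OF I(1) B])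
    then have "ln (block_sum I B n) \<le> ln (real (card I) ^ (card I * n))"
      using pos[of n] c by (subst ln_le_cancel_iff) auto
    then show ?thesis using c by (simp add: ln_realpow algebra_simps)
  qed
qed

lemma convergent_ln_block_permanent:
  assumes I: "finite I" "I \<noteq> {}" and B: "\<And>i j. i \<in> I \<Longrightarrow> j \<in> I \<Longrightarrow> 0 < B i j \<and> B i j \<le> 1"
  shows "convergent (\<lambda>m. (ln (permanent (I \<times> {..<m}) (\<lambda>x y. B (fst x) (fst y))) - ln (fact (card I * m)))
    / real (card I * m))"
proof -
  let ?G = "block_sum I B" and ?G1 = "block_sum I (\<lambda>_ _. 1)"
  have pos: "0 < ?G m" for m by (rule block_sum_pos[OF I(1)]) (use B in blast)
  have "(ln (permanent (I \<times> {..<m}) (\<lambda>x y. B (fst x) (fst y))) - ln (fact (card I * m))) / real (card I * m)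
      = (ln (?G m) / real m - ln (?G1 m) / real m) * (1 / real (card I))" for m
  proof -
    have "fact (card I * m) = permanent (I \<times> {..<m}) (\<lambda>x y. 1)"
      using I by (subst permanent_const) auto
    also have "\<dots> = fact m ^ card I * ?G1 m" using block_permanent_eq[OF I(1), of m "\<lambda>_ _. 1"] by simp
    finally have "ln (fact (card I * m)) = ln (fact m ^ card I) + ln (?G1 m)"
      using block_sum_pos[OF I(1), of "\<lambda>_ _. 1" m] by (simp add: ln_mult)
    moreover have "ln (permanent (I \<times> {..<m}) (\<lambda>x y. B (fst x) (fst y))) = ln (fact m ^ card I) + ln (?G m)"
      using pos[of m] I by (simp add: block_permanent_eq ln_mult)
    ultimately show ?thesis by (simp add: diff_divide_distrib mult.commute)
  qed
  moreover have "convergent (\<lambda>m. (ln (?G m) / real m - ln (?G1 m) / real m) * (1 / real (card I)))"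
    by (intro convergent_mult convergent_diff convergent_const convergent_ln_block_sum I B) auto
  ultimately show ?thesis by simp
qed

section \<open>The scaling limit\<close>

lemma ln_permanent_exp_close:
  assumes S: "finite S" and fg: "\<And>x y. x \<in> S \<Longrightarrow> y \<in> S \<Longrightarrow> \<bar>f x y - g x y\<bar> \<le> \<epsilon>"
  shows "\<bar>ln (permanent S (\<lambda>x y. exp (- f x y))) - ln (permanent S (\<lambda>x y. exp (- g x y)))\<bar> \<le> real (card S) * \<epsilon>"
proof -
  have le: "ln (permanent S (\<lambda>x y. exp (- f x y))) \<le> real (card S) * \<epsilon> + ln (permanent S (\<lambda>x y. exp (- g x y)))"
    if fg: "\<And>x y. x \<in> S \<Longrightarrow> y \<in> S \<Longrightarrow> \<bar>f x y - g x y\<bar> \<le> \<epsilon>" for f g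
  proof -
    have pos: "0 < permanent S (\<lambda>x y. exp (- f x y))" "0 < permanent S (\<lambda>x y. exp (- g x y))"
      using S by (auto intro: permanent_pos)
    have "permanent S (\<lambda>x y. exp (- f x y)) \<le> exp \<epsilon> ^ card S * permanent S (\<lambda>x y. exp (- g x y))"
    proof (rule permanent_mono)
      fix x y assume "x \<in> S" "y \<in> S"
      from fg[OF this] show "exp (- f x y) \<le> exp \<epsilon> * exp (- g x y)"
        unfolding exp_add[symmetric] by simp
    qed simp
    then have "ln (permanent S (\<lambda>x y. exp (- f x y))) \<le> ln (exp \<epsilon> ^ card S * permanent S (\<lambda>x y. exp (- g x y)))"
      using pos by (subst ln_le_cancel_iff) auto
    then show ?thesis using pos by (simp add: ln_mult ln_realpow)
  qed
  show ?thesis using le[of f g] le[of g f] fg by (auto simp: abs_minus_commute abs_le_iff)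
qed

definition scaled_free_energy :: "'d::finite itself \<Rightarrow> real \<Rightarrow> nat \<Rightarrow> real" where
  "scaled_free_energy _ c N =
    (ln (partition_fun TYPE('d) N (c / real N)) - ln (fact (N ^ CARD('d)))) / real (N ^ CARD('d))"

lemma partition_fun_scaled:
  "partition_fun TYPE('d::finite) N (c / real N) =
    permanent (lattice_box N :: (real ^ 'd) set) (\<lambda>x y. exp (- (c / real N * norm (x - y))))"
  by (simp add: partition_fun_eq_permanent)

lemma lattice_box_mono: "N' \<le> N \<Longrightarrow> lattice_box N' \<subseteq> (lattice_box N :: (real ^ 'd::finite) set)"
  unfolding lattice_box_def by (intro Collect_mono) (meson atLeastatMost_subset_iff image_mono order_refl subsetD)

lemma scaled_free_energy_diff_bound:
  assumes c: "0 \<le> c" and N: "1 \<le> N'" "N' \<le> N"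
  shows "\<bar>scaled_free_energy TYPE('d::finite) c N - scaled_free_energy TYPE('d) c N'\<bar> \<le>
    c * real CARD('d) * (3 * (1 - (real N' / real N) ^ CARD('d)) + (1 - real N' / real N))"
proof -
  let ?B = "lattice_box :: nat \<Rightarrow> (real ^ 'd) set"
  define C where "C = c * real CARD('d)"
  define n n' where "n = real (N ^ CARD('d))" and "n' = real (N' ^ CARD('d))"
  have C: "0 \<le> C" using c by (simp add: C_def)
  have n: "0 < n" "0 < n'" "n' \<le> n"
    using N by (simp_all add: n_def n'_def power_mono)
  have \<rho>: "n' / n = (real N' / real N) ^ CARD('d)" by (simp add: n_def n'_def power_divide)
  define K where "K N x y = exp (- (c / real N * norm (x - y)))" for N and x y :: "real ^ 'd"
  define p where "p = ln (permanent (?B N) (K N)) - ln (fact (card (?B N)))"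
  define p1 where "p1 = ln (permanent (?B N') (K N)) - ln (fact (card (?B N')))"
  define p2 where "p2 = ln (permanent (?B N') (K N')) - ln (fact (card (?B N')))"
  have dist: "c / real k * norm (x - y) \<le> C * (real l / real k)"
    if "x \<in> ?B l" "y \<in> ?B l" for k l x y
  proof -
    have "c / real k * norm (x - y) \<le> c / real k * (real CARD('d) * real l)"
      using c lattice_box_norm_diff[OF that] by (intro mult_left_mono) auto
    then show ?thesis by (simp add: C_def)
  qed
  have "\<bar>p - p1\<bar> \<le> 2 * C * (n - n')"
  proof -
    have "exp (- C) \<le> K N x y \<and> K N x y \<le> 1" if "x \<in> ?B N" "y \<in> ?B N" for x y
      using dist[OF that, of N] N c by (simp add: K_def)
    from ln_permanent_subset[OF finite_lattice_box lattice_box_mono[OF N(2)] C this] show ?thesis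
      by (simp add: p_def p1_def n_def n'_def card_lattice_box)
  qed
  moreover have "\<bar>p1 - p2\<bar> \<le> n' * (C * (1 - real N' / real N))"
  proof -
    have "\<bar>c / real N * norm (x - y) - c / real N' * norm (x - y)\<bar> \<le> C * (1 - real N' / real N)"
      if "x \<in> ?B N'" "y \<in> ?B N'" for x y
    proof -
      have r: "real N' / real N \<le> 1" "0 \<le> real N' / real N" using N by auto
      define t where "t = c / real N' * norm (x - y)"
      have "0 \<le> t" using c by (simp add: t_def)
      have "\<bar>t * (real N' / real N) - t\<bar> = \<bar>t * (1 - real N' / real N)\<bar>"
        by (simp only: right_diff_distrib mult_1_right abs_minus_commute)
      moreover have "c / real N * norm (x - y) = t * (real N' / real N)" using N by (simp add: t_def)
      ultimately have "\<bar>c / real N * norm (x - y) - t\<bar> = t * (1 - real N' / real N)"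
        using r \<open>0 \<le> t\<close> by (simp only: abs_mult)
      then have "\<bar>c / real N * norm (x - y) - c / real N' * norm (x - y)\<bar>
          = c / real N' * norm (x - y) * (1 - real N' / real N)"
        by (simp only: t_def)
      also have "\<dots> \<le> C * (1 - real N' / real N)"
        using dist[OF that, of N'] N r by (intro mult_right_mono) auto
      finally show ?thesis .
    qed
    with ln_permanent_exp_close[of "?B N'" "\<lambda>x y. c / real N * norm (x - y)"
        "\<lambda>x y. c / real N' * norm (x - y)" "C * (1 - real N' / real N)"]
    show ?thesis
      by (simp add: p1_def p2_def K_def[abs_def] n'_def card_lattice_box)
  qed
  moreover have "\<bar>p2\<bar> \<le> n' * C"
  proof -
    have "\<bar>c / real N' * norm (x - y) - 0\<bar> \<le> C" if "x \<in> ?B N'" "y \<in> ?B N'" for x y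
      using dist[OF that, of N'] N c by simp
    with ln_permanent_exp_close[of "?B N'" "\<lambda>x y. c / real N' * norm (x - y)" "\<lambda>x y. 0" C]
    show ?thesis
      by (simp add: p2_def K_def[abs_def] n'_def card_lattice_box permanent_const)
  qed
  ultimately have 1: "\<bar>p - p2\<bar> \<le> 2 * C * (n - n') + n' * (C * (1 - real N' / real N))"
    and 2: "\<bar>p2\<bar> \<le> n' * C" by linarith+
  have "p / n - p2 / n' = (p - p2) / n - p2 / n' * (1 - n' / n)"
    using n by (simp add: field_simps)
  then have "\<bar>p / n - p2 / n'\<bar> \<le> \<bar>(p - p2) / n\<bar> + \<bar>p2 / n' * (1 - n' / n)\<bar>" by linarith
  also have "\<bar>p2 / n' * (1 - n' / n)\<bar> \<le> C * (1 - n' / n)"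
  proof -
    have "\<bar>p2 / n'\<bar> \<le> C" using 2 n by (simp add: pos_divide_le_eq mult.commute)
    moreover have nonneg: "0 \<le> 1 - n' / n" using n by simp
    moreover from nonneg have "\<bar>p2 / n' * (1 - n' / n)\<bar> = \<bar>p2 / n'\<bar> * (1 - n' / n)"
      by (simp only: abs_mult abs_of_nonneg)
    ultimately show ?thesis by (simp only: mult_right_mono)
  qed
  also have "\<bar>(p - p2) / n\<bar> \<le> (2 * C * (n - n') + n' * (C * (1 - real N' / real N))) / n"
    using 1 n by (simp add: divide_right_mono)
  also have "\<dots> = 2 * C * (1 - n' / n) + n' / n * (C * (1 - real N' / real N))"
    using n by (simp add: field_simps)
  also have "n' / n * (C * (1 - real N' / real N)) \<le> 1 * (C * (1 - real N' / real N))"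
    using n C N by (intro mult_right_mono) auto
  finally show ?thesis
    using N
    by (simp add: scaled_free_energy_def partition_fun_scaled p_def p2_def K_def[abs_def] n_def n'_def
        card_lattice_box C_def power_divide algebra_simps)
qed

lemma scaled_free_energy_multiple_diff_tendsto_0:
  assumes c: "0 \<le> c" and M: "1 \<le> M"
  shows "(\<lambda>N. scaled_free_energy TYPE('d::finite) c N - scaled_free_energy TYPE('d) c (M * (N div M)))
    \<longlonglongrightarrow> 0"
proof -
  let ?r = "\<lambda>N. real (M * (N div M)) / real N"
  have lim1: "?r \<longlonglongrightarrow> 1"
  proof (rule tendsto_sandwich)
    show "(\<lambda>N. 1 - real M / real N) \<longlonglongrightarrow> 1"
      using tendsto_diff[OF tendsto_const[of 1] lim_const_over_n[of "real M"]] by simp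
    show "eventually (\<lambda>N. 1 - real M / real N \<le> ?r N) sequentially"
      using eventually_ge_at_top[of "1::nat"]
    proof eventually_elim
      case (elim N)
      have "N = M * (N div M) + N mod M" by simp
      moreover have "N mod M < M" using M by simp
      ultimately have "real N - real M \<le> real (M * (N div M))" by linarith
      then have "(real N - real M) / real N \<le> ?r N" by (rule divide_right_mono) simp
      then show ?case using elim by (simp add: diff_divide_distrib)
    qed
    show "eventually (\<lambda>N. ?r N \<le> 1) sequentially"
      using eventually_ge_at_top[of "1::nat"]
      by eventually_elim (simp flip: of_nat_mult)
  qed simp
  have "(\<lambda>N. c * real CARD('d) * (3 * (1 - ?r N ^ CARD('d)) + (1 - ?r N)))
      \<longlonglongrightarrow> c * real CARD('d) * (3 * (1 - 1 ^ CARD('d)) + (1 - 1))"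
    by (intro tendsto_intros lim1)
  then have lim0: "(\<lambda>N. c * real CARD('d) * (3 * (1 - ?r N ^ CARD('d)) + (1 - ?r N))) \<longlonglongrightarrow> 0"
    by simp
  show ?thesis
  proof (rule Lim_null_comparison[OF _ lim0])
    show "eventually (\<lambda>N. norm (scaled_free_energy TYPE('d) c N - scaled_free_energy TYPE('d) c (M * (N div M)))
        \<le> c * real CARD('d) * (3 * (1 - ?r N ^ CARD('d)) + (1 - ?r N))) sequentially"
      using eventually_ge_at_top[of M]
    proof eventually_elim
      case (elim N)
      have "0 < N div M" using elim M by (simp add: div_greater_zero_iff)
      then have "1 \<le> M * (N div M)" using M by simp
      then show ?case
        unfolding real_norm_def by (intro scaled_free_energy_diff_bound[OF c]) auto
    qed
  qed
qed

text \<open>Each coordinate is \<open>\<lceil>x $ i / k\<rceil>\<close>, computed with natural division.\<close>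

definition coarse_point :: "nat \<Rightarrow> real ^ 'd::finite \<Rightarrow> real ^ 'd" where
  "coarse_point k x = (\<chi> i. real ((nat \<lfloor>x $ i\<rfloor> - 1) div k + 1))"

lemma coarse_point_in_lattice_box:
  assumes k: "0 < k" and x: "x \<in> lattice_box (M * k)"
  shows "coarse_point k x \<in> lattice_box M"
proof -
  have "(nat \<lfloor>x $ i\<rfloor> - 1) div k + 1 \<in> {1..M}" for i
  proof -
    obtain a where a: "x $ i = real a" "1 \<le> a" "a \<le> M * k" by (rule lattice_box_nth[OF x])
    then have "(a - 1) div k < M" using k by (intro less_mult_imp_div_less) linarith
    then show ?thesis using a by simp
  qed
  then show ?thesis
    unfolding lattice_box_def coarse_point_def mem_Collect_eq vec_lambda_beta by (intro allI imageI)
qed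

lemma card_coarse_point_fiber:
  assumes k: "0 < k" and u: "u \<in> lattice_box M"
  shows "card {x \<in> lattice_box (M * k). coarse_point k x = (u :: real ^ 'd::finite)} = k ^ CARD('d)"
proof -
  define A where "A i = {a\<in>{1..M * k}. real ((a - 1) div k + 1) = u $ i}" for i
  have "card (A i) = k" for i
  proof -
    obtain j where j: "u $ i = real j" "1 \<le> j" "j \<le> M" by (rule lattice_box_nth[OF u])
    then obtain e where e: "j = Suc e" by (cases j) auto
    have "A i = {e * k + 1..e * k + k}"
    proof safe
      fix a assume "a \<in> A i"
      then have a: "1 \<le> a" "(a - 1) div k = e" by (auto simp: A_def j e)
      obtain r where "a - 1 = e * k + r" "r < k"
        using k a(2) by (metis div_mult_mod_eq mod_less_divisor)
      then show "a \<in> {e * k + 1..e * k + k}" using a by auto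
    next
      fix a assume a: "a \<in> {e * k + 1..e * k + k}"
      then have "(a - 1) div k = e" by (intro div_nat_eqI) (auto simp: mult.commute)
      moreover have "Suc e * k \<le> M * k" using j e by (intro mult_le_mono1) simp
      ultimately show "a \<in> A i" using a by (auto simp: A_def j e)
    qed
    then show ?thesis by simp
  qed
  moreover have "{x \<in> lattice_box (M * k). coarse_point k x = u} = {x. \<forall>i. x $ i \<in> real ` A i}"
  proof -
    have "r \<in> real ` A i \<longleftrightarrow> r \<in> real ` {1..M * k} \<and> real ((nat \<lfloor>r\<rfloor> - 1) div k + 1) = u $ i" for r i
      by (auto simp: A_def)
    then show ?thesis by (auto simp: lattice_box_def coarse_point_def vec_eq_iff)
  qed
  moreover have "finite (A i)" for i by (simp add: A_def)
  ultimately show ?thesis by (simp add: card_vec_Pi card_image)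
qed

lemma norm_coarse_point_le:
  fixes x :: "real ^ 'd::finite"
  assumes k: "0 < k" and x: "x \<in> lattice_box N"
  shows "norm (x /\<^sub>R real k - coarse_point k x) \<le> real CARD('d)"
proof -
  have "\<bar>(x /\<^sub>R real k - coarse_point k x) $ i\<bar> \<le> 1" for i
  proof -
    obtain a where a: "x $ i = real a" "1 \<le> a" "a \<le> N" by (rule lattice_box_nth[OF x])
    obtain e r where er: "a - 1 = e * k + r" "r < k" "(a - 1) div k = e"
      using k by (metis div_mult_mod_eq mod_less_divisor)
    have "real a = real e * real k + real r + 1"
    proof -
      have "a = e * k + r + 1" using er(1) a by linarith
      then show ?thesis by simp
    qed
    moreover have "real r + 1 \<le> real k" using er by simp
    ultimately have "real a / real k \<le> real e + 1" "real e \<le> real a / real k"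
      using k by (simp_all add: field_simps)
    then show ?thesis using a er by (simp add: coarse_point_def divide_inverse mult.commute)
  qed
  then have "(\<Sum>i\<in>UNIV. \<bar>(x /\<^sub>R real k - coarse_point k x) $ i\<bar>) \<le> real CARD('d) * 1"
    by (intro sum_bounded_above)
  then show ?thesis using norm_le_l1_cart[of "x /\<^sub>R real k - coarse_point k x"] by linarith
qed

definition block_free_energy :: "'d::finite itself \<Rightarrow> real \<Rightarrow> nat \<Rightarrow> nat \<Rightarrow> real" where
  "block_free_energy _ c M m =
    (ln (permanent ((lattice_box M :: (real ^ 'd) set) \<times> {..<m})
        (\<lambda>x y. exp (- (c / real M * norm (fst x - fst y))))) - ln (fact (M ^ CARD('d) * m)))
      / real (M ^ CARD('d) * m)"

lemma convergent_block_free_energy: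
  assumes c: "0 \<le> c" and M: "1 \<le> M"
  shows "convergent (block_free_energy TYPE('d::finite) c M)"
proof -
  let ?B = "lattice_box M :: (real ^ 'd) set"
  have "card ?B > 0" using M by (simp add: card_lattice_box)
  then have "?B \<noteq> {}" by auto
  from convergent_ln_block_permanent[OF finite_lattice_box this,
      of "\<lambda>u v. exp (- (c / real M * norm (u - v)))"] c
  show ?thesis
    by (simp add: block_free_energy_def[abs_def] card_lattice_box)
qed

lemma scaled_free_energy_block_approx:
  assumes c: "0 \<le> c" and M: "1 \<le> M" and k: "1 \<le> k"
  shows "\<bar>scaled_free_energy TYPE('d::finite) c (M * k) - block_free_energy TYPE('d) c M (k ^ CARD('d))\<bar>
    \<le> 2 * c * real CARD('d) / real M"
proof -
  let ?S = "lattice_box (M * k) :: (real ^ 'd) set" and ?I = "lattice_box M :: (real ^ 'd) set"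
  let ?d = "real CARD('d)"
  let ?b = "coarse_point k :: real ^ 'd \<Rightarrow> real ^ 'd"
  let ?f = "\<lambda>x y :: real ^ 'd. c / real (M * k) * norm (x - y)"
  let ?g = "\<lambda>x y :: real ^ 'd. c / real M * norm (?b x - ?b y)"
  have k0: "0 < k" using k by simp
  have bI: "?b ` ?S \<subseteq> ?I" using coarse_point_in_lattice_box[OF k0] by blast
  obtain h where h: "bij_betw h ?S (?I \<times> {..<k ^ CARD('d)})" "\<And>x. x \<in> ?S \<Longrightarrow> fst (h x) = ?b x"
    by (rule equal_fibers_trivialize[OF finite_lattice_box bI card_coarse_point_fiber[OF k0]]) blast+
  have "permanent (?I \<times> {..<k ^ CARD('d)}) (\<lambda>x y. exp (- (c / real M * norm (fst x - fst y))))
      = permanent ?S (\<lambda>x y. exp (- (c / real M * norm (fst (h x) - fst (h y)))))"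
    by (rule permanent_reindex[OF h(1)])
  also have "\<dots> = permanent ?S (\<lambda>x y. exp (- ?g x y))"
    unfolding permanent_def using h(2)
    by (intro sum.cong prod.cong) (auto simp: permutes_in_image)
  finally have eq: "permanent (?I \<times> {..<k ^ CARD('d)}) (\<lambda>x y. exp (- (c / real M * norm (fst x - fst y))))
      = permanent ?S (\<lambda>x y. exp (- ?g x y))" .
  have "\<bar>?f x y - ?g x y\<bar> \<le> 2 * c * ?d / real M" if xy: "x \<in> ?S" "y \<in> ?S" for x y
  proof -
    let ?x = "x /\<^sub>R real k" and ?y = "y /\<^sub>R real k"
    have "norm (x - y) / real k = norm (?x - ?y)"
      using k by (simp add: scaleR_diff_right[symmetric] divide_inverse mult.commute)
    then have "?f x y - ?g x y = c / real M * (norm (?x - ?y) - norm (?b x - ?b y))"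
      using k by (simp add: right_diff_distrib flip: times_divide_times_eq)
    also have "\<bar>\<dots>\<bar> = c / real M * \<bar>norm (?x - ?y) - norm (?b x - ?b y)\<bar>"
      using c by (simp add: abs_mult)
    also have "\<dots> \<le> c / real M * (2 * ?d)"
    proof (rule mult_left_mono)
      have "\<bar>norm (?x - ?y) - norm (?b x - ?b y)\<bar> \<le> norm ((?x - ?y) - (?b x - ?b y))"
        by (rule norm_triangle_ineq3)
      also have "(?x - ?y) - (?b x - ?b y) = (?x - ?b x) - (?y - ?b y)" by simp
      also have "norm \<dots> \<le> norm (?x - ?b x) + norm (?y - ?b y)" by (rule norm_triangle_ineq4)
      finally show "\<bar>norm (?x - ?y) - norm (?b x - ?b y)\<bar> \<le> 2 * ?d"
        using norm_coarse_point_le[OF k0 xy(1)] norm_coarse_point_le[OF k0 xy(2)] by linarith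
    qed (use c in auto)
    finally show ?thesis by (simp add: mult_ac)
  qed
  with ln_permanent_exp_close[of ?S ?f ?g "2 * c * ?d / real M"]
  have "\<bar>ln (permanent ?S (\<lambda>x y. exp (- ?f x y))) - ln (permanent ?S (\<lambda>x y. exp (- ?g x y)))\<bar>
      \<le> real ((M * k) ^ CARD('d)) * (2 * c * ?d / real M)"
    by (simp only: card_lattice_box finite_lattice_box)
  then have "\<bar>ln (permanent ?S (\<lambda>x y. exp (- ?f x y))) - ln (permanent ?S (\<lambda>x y. exp (- ?g x y)))\<bar>
      / real ((M * k) ^ CARD('d)) \<le> 2 * c * ?d / real M"
    using M k by (subst pos_divide_le_eq) (auto simp: mult.commute)
  moreover have "scaled_free_energy TYPE('d) c (M * k) - block_free_energy TYPE('d) c M (k ^ CARD('d))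
      = (ln (permanent ?S (\<lambda>x y. exp (- ?f x y))) - ln (permanent ?S (\<lambda>x y. exp (- ?g x y))))
        / real ((M * k) ^ CARD('d))"
    unfolding scaled_free_energy_def block_free_energy_def partition_fun_scaled eq power_mult_distrib[symmetric]
    by (simp only: diff_divide_distrib)
  ultimately show ?thesis by simp
qed

lemma convergent_scaled_free_energy:
  assumes c: "0 \<le> c"
  shows "convergent (scaled_free_energy TYPE('d::finite) c)"
proof -
  let ?\<phi> = "scaled_free_energy TYPE('d) c"
  define C where "C = 2 * c * real CARD('d)"
  have C: "0 \<le> C" using c by (simp add: C_def)
  have near: "\<exists>l. eventually (\<lambda>N. \<bar>?\<phi> N - l\<bar> < (C + 2) / real M) sequentially" if M: "1 \<le> M" for M
  proof -
    let ?w = "block_free_energy TYPE('d) c M"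
    obtain l where l: "?w \<longlonglongrightarrow> l"
      using convergent_block_free_energy[OF c M] by (auto simp: convergent_def)
    have "filterlim (\<lambda>N. (N div M) ^ CARD('d)) at_top sequentially"
    proof (rule filterlim_at_top_mono)
      show "filterlim (\<lambda>N. N div M) at_top sequentially"
        using M by (intro filterlim_at_top_div_const_nat) simp
      show "eventually (\<lambda>N. N div M \<le> (N div M) ^ CARD('d)) sequentially"
        using eventually_ge_at_top[of M]
      proof eventually_elim
        case (elim N)
        then have "1 \<le> N div M" using M by (simp add: Suc_leI div_greater_zero_iff)
        then show ?case by (rule self_le_power) simp
      qed
    qed
    from filterlim_compose[OF l this] have lim: "(\<lambda>N. ?w ((N div M) ^ CARD('d))) \<longlonglongrightarrow> l" .
    have M1: "0 < 1 / real M" using M by simp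
    have "eventually (\<lambda>N. \<bar>?w ((N div M) ^ CARD('d)) - l\<bar> < 1 / real M) sequentially"
      using tendstoD[OF lim M1] by (simp add: dist_real_def)
    moreover have "eventually (\<lambda>N. \<bar>?\<phi> N - ?\<phi> (M * (N div M))\<bar> < 1 / real M) sequentially"
      using tendstoD[OF scaled_free_energy_multiple_diff_tendsto_0[OF c M, where 'd='d] M1]
      by (simp add: dist_real_def)
    ultimately have "eventually (\<lambda>N. \<bar>?\<phi> N - l\<bar> < (C + 2) / real M) sequentially"
      using eventually_ge_at_top[of M]
    proof eventually_elim
      case (elim N)
      have "1 \<le> N div M" using elim M by (simp add: Suc_leI div_greater_zero_iff)
      from scaled_free_energy_block_approx[OF c M this, where 'd='d]
      have "\<bar>?\<phi> (M * (N div M)) - ?w ((N div M) ^ CARD('d))\<bar> \<le> C / real M" by (simp add: C_def)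
      moreover have "(C + 2) / real M = C / real M + 1 / real M + 1 / real M" by (simp add: add_divide_distrib)
      ultimately show ?case using elim by linarith
    qed
    then show ?thesis by blast
  qed
  have "Cauchy ?\<phi>"
  proof (rule metric_CauchyI)
    fix e :: real assume e: "0 < e"
    obtain M :: nat where M: "2 * (C + 2) / e < real M" using reals_Archimedean2 by blast
    then have M0: "0 < real M" using C e by (smt (verit) divide_pos_pos)
    then have M1: "1 \<le> M" by simp
    have small: "(C + 2) / real M < e / 2" using M M0 e by (simp add: field_simps)
    obtain l N0 where "\<And>N. N0 \<le> N \<Longrightarrow> \<bar>?\<phi> N - l\<bar> < (C + 2) / real M"
      using near[OF M1] by (auto simp: eventually_sequentially)
    then have "dist (?\<phi> m) (?\<phi> n) < e" if "N0 \<le> m" "N0 \<le> n" for m n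
      using that small by (smt (verit) dist_real_def field_sum_of_halves)
    then show "\<exists>N0. \<forall>m\<ge>N0. \<forall>n\<ge>N0. dist (?\<phi> m) (?\<phi> n) < e" by blast
  qed
  then show ?thesis by (simp add: Cauchy_convergent_iff)
qed

lemma scaled_free_energy_slope_le:
  assumes N: "1 \<le> N"
  shows "scaled_free_energy TYPE('d::finite) c N - scaled_free_energy TYPE('d) c' N
    \<le> (c' - c) * (mean_displacement TYPE('d) N (c / real N) / real N)"
proof -
  let ?n = "real (N ^ CARD('d))" and ?D = "mean_displacement TYPE('d) N (c / real N)"
  have n: "0 < ?n" using N by simp
  have "ln (partition_fun TYPE('d) N (c / real N)) - ln (partition_fun TYPE('d) N (c' / real N))
      \<le> (c' / real N - c / real N) * (?n * ?D)"
    using ln_partition_fun_ge_tangent[OF N, of "c / real N" "c' / real N", where 'd='d] by simp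
  also have "\<dots> = (c' - c) * (?D / real N) * ?n" by (simp add: diff_divide_distrib[symmetric])
  finally have "(ln (partition_fun TYPE('d) N (c / real N)) - ln (partition_fun TYPE('d) N (c' / real N))) / ?n
      \<le> (c' - c) * (?D / real N)"
    using n by (subst pos_divide_le_eq)
  then show ?thesis by (simp add: scaled_free_energy_def diff_divide_distrib)
qed

lemma mean_displacement_scaling_limit:
  obtains f :: "real \<Rightarrow> real" where "\<And>c. 0 < c \<Longrightarrow> 0 < f c" "antimono_on {0<..} f"
    "\<And>c. 0 < c \<Longrightarrow> isCont f c \<Longrightarrow>
      (\<lambda>N. mean_displacement TYPE('d::finite) N (c / real N) / real N) \<longlonglongrightarrow> f c"
proof -
  define e where "e c N = mean_displacement TYPE('d) N (c / real N) / real N" for c N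
  let ?\<phi> = "scaled_free_energy TYPE('d)"
  define \<phi> where "\<phi> c = lim (?\<phi> c)" for c
  have lim: "?\<phi> c \<longlonglongrightarrow> \<phi> c" if "0 < c" for c
    using convergent_scaled_free_energy[of c, where 'd='d] that unfolding \<phi>_def convergent_LIMSEQ_iff by simp
  define s where "s c c' = (\<phi> c - \<phi> c') / (c' - c)" for c c'
  define sN where "sN c c' N = (?\<phi> c N - ?\<phi> c' N) / (c' - c)" for c c' N
  have lim_s: "sN c c' \<longlonglongrightarrow> s c c'" if "0 < c" "c < c'" for c c'
    unfolding sN_def s_def using that by (intro tendsto_intros lim) auto
  have sN_le: "sN c c' N \<le> e c N" if "c < c'" "1 \<le> N" for c c' N
    using scaled_free_energy_slope_le[OF that(2), of c c', where 'd='d] that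
    by (simp add: sN_def e_def pos_divide_le_eq mult.commute)
  have le_sN: "e c' N \<le> sN c c' N" if "c < c'" "1 \<le> N" for c c' N
  proof -
    have "?\<phi> c' N - ?\<phi> c N \<le> (c - c') * e c' N"
      using scaled_free_energy_slope_le[OF that(2), of c' c, where 'd='d] by (simp add: e_def)
    then have "e c' N * (c' - c) \<le> ?\<phi> c N - ?\<phi> c' N" by (simp add: algebra_simps)
    then show ?thesis using that(1) by (simp add: sN_def pos_le_divide_eq)
  qed
  have e_le: "e c N \<le> real CARD('d)" if "1 \<le> N" for c N
    using mean_displacement_bounds(2)[OF that, of "c / real N", where 'd='d] that
    by (simp add: e_def pos_divide_le_eq)
  have s_le: "s c c' \<le> real CARD('d)" if "0 < c" "c < c'" for c c'
  proof (rule LIMSEQ_le_const2[OF lim_s[OF that]])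
    show "\<exists>N. \<forall>n\<ge>N. sN c c' n \<le> real CARD('d)"
      using order_trans[OF sN_le[OF that(2)] e_le] by blast
  qed
  \<comment> \<open>minus the right derivative of the convex function \<open>\<phi>\<close>\<close>
  define f where "f c = (SUP c'\<in>{c<..}. s c c')" for c
  have bdd: "bdd_above (s c ` {c<..})" if "0 < c" for c
    using s_le[OF that] by (intro bdd_aboveI[of _ "real CARD('d)"]) auto
  have lower: "eventually (\<lambda>N. a < e c N) sequentially" if c: "0 < c" and a: "a < f c" for c a
  proof -
    obtain c' where c': "c < c'" "a < s c c'"
      using a unfolding f_def by (subst (asm) less_cSUP_iff[OF _ bdd[OF c]]) auto
    have "eventually (\<lambda>N. a < sN c c' N) sequentially"
      by (rule order_tendstoD(1)[OF lim_s[OF c c'(1)] c'(2)])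
    then show ?thesis using eventually_ge_at_top[of "1::nat"]
      by eventually_elim (use sN_le[OF c'(1)] less_le_trans in blast)
  qed
  have upper: "eventually (\<lambda>N. e c' N < a) sequentially" if c: "0 < c" "c < c'" and a: "f c < a" for c c' a
  proof -
    have "s c c' \<le> f c" unfolding f_def using c by (intro cSUP_upper bdd) auto
    then have "eventually (\<lambda>N. sN c c' N < a) sequentially"
      using a by (intro order_tendstoD(2)[OF lim_s[OF c]]) linarith
    then show ?thesis using eventually_ge_at_top[of "1::nat"]
      by eventually_elim (use le_sN[OF c(2)] le_less_trans in blast)
  qed
  have anti: "f c' \<le> f c" if c: "0 < c" "c < c'" for c c'
  proof (rule ccontr)
    assume "\<not> f c' \<le> f c"
    then obtain a where a: "f c < a" "a < f c'" using dense[of "f c" "f c'"] by (auto simp: not_le)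
    have "eventually (\<lambda>N. False) sequentially"
      using upper[OF c a(1)] lower[OF less_trans[OF c] a(2)] by eventually_elim simp
    then show False by simp
  qed
  show ?thesis
  proof
    fix c :: real assume c: "0 < c"
    obtain \<delta> where \<delta>: "0 < \<delta>"
      "eventually (\<lambda>N. \<delta> * real N \<le> mean_displacement TYPE('d) N ((c + 1) / real N)) at_top"
      by (rule mean_displacement_ge_linear)
    show "0 < f c"
    proof (rule ccontr)
      assume "\<not> 0 < f c"
      then have "f c < \<delta>" using \<delta>(1) by linarith
      from upper[OF c _ this, of "c + 1"] have "eventually (\<lambda>N. e (c + 1) N < \<delta>) sequentially" by simp
      with \<delta>(2) have "eventually (\<lambda>N. False) sequentially"
        using eventually_ge_at_top[of "1::nat"]
        proof eventually_elim
          case (elim N)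
          then have "0 < real N" by simp
          with elim show ?case unfolding e_def by (simp only: pos_divide_less_eq)
        qed
      then show False by simp
    qed
  next
    show "antimono_on {0<..} f"
    proof (rule monotone_onI)
      fix x y :: real assume "x \<in> {0<..}" "x \<le> y"
      then show "f y \<le> f x" using anti[of x y] by (cases "x = y") auto
    qed
  next
    fix c assume c: "0 < c" "isCont f c"
    have "e c \<longlonglongrightarrow> f c"
    proof (rule order_tendstoI)
      fix a assume "a < f c"
      then show "eventually (\<lambda>N. a < e c N) sequentially" by (rule lower[OF c(1)])
    next
      fix a assume "f c < a"
      then have "eventually (\<lambda>x. f x < a) (at_left c)"
        using c(2) by (intro order_tendstoD(2)[of f "f c"]) (auto simp: isCont_def filterlim_at_split)
      moreover have "eventually (\<lambda>x. 0 < x) (at_left c)"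
        using c(1) by (auto simp: eventually_at_left)
      moreover have "eventually (\<lambda>x. x < c) (at_left c)"
        by (simp add: eventually_at_filter)
      ultimately have "eventually (\<lambda>x. f x < a \<and> 0 < x \<and> x < c) (at_left c)"
        by eventually_elim simp
      then obtain x where "f x < a" "0 < x" "x < c"
        using eventually_happens trivial_limit_at_left_real by blast
      then show "eventually (\<lambda>N. e c N < a) sequentially" by (intro upper)
    qed
    then show "(\<lambda>N. mean_displacement TYPE('d) N (c / real N) / real N) \<longlonglongrightarrow> f c"
      by (simp add: e_def[abs_def])
  qed
qed

theorem theorem1p1:
  shows
    "(\<forall>\<beta> :: nat \<Rightarrow> real. (\<forall>N\<ge>1. 0 \<le> \<beta> N) \<longrightarrow>
        (\<lambda>N. 1 / real N) \<in> o(\<beta>) \<longrightarrow> \<beta> \<in> o(\<lambda>_. 1) \<longrightarrow>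
        (\<lambda>N. mean_displacement TYPE('d::finite) N (\<beta> N)) \<in> \<Theta>(\<lambda>N. 1 / \<beta> N)) \<and>
     (\<forall>\<beta> :: nat \<Rightarrow> real. (\<forall>N\<ge>1. 0 \<le> \<beta> N) \<longrightarrow>
        \<beta> \<in> O(\<lambda>N. 1 / real N) \<longrightarrow>
        (\<lambda>N. mean_displacement TYPE('d) N (\<beta> N)) \<in> \<Theta>(\<lambda>N. real N)) \<and>
     (\<exists>(f :: real \<Rightarrow> real) (C :: real set).
        (\<forall>c>0. f c > 0) \<and> antimono_on {0<..} f \<and> countable C \<and> C \<subseteq> {0<..} \<and>
        (\<forall>c \<in> {0<..} - C.
           (\<lambda>N. mean_displacement TYPE('d) N (c / real N)) \<sim>[at_top] (\<lambda>N. real N * f c)))"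
proof (intro conjI allI impI)
  fix \<beta> :: "nat \<Rightarrow> real"
  assume "\<forall>N\<ge>1. 0 \<le> \<beta> N" "(\<lambda>N. 1 / real N) \<in> o(\<beta>)" "\<beta> \<in> o(\<lambda>_. 1)"
  then show "(\<lambda>N. mean_displacement TYPE('d) N (\<beta> N)) \<in> \<Theta>(\<lambda>N. 1 / \<beta> N)"
    by (rule mean_displacement_inverse_bigtheta)
next
  fix \<beta> :: "nat \<Rightarrow> real"
  assume "\<forall>N\<ge>1. 0 \<le> \<beta> N" "\<beta> \<in> O(\<lambda>N. 1 / real N)"
  then show "(\<lambda>N. mean_displacement TYPE('d) N (\<beta> N)) \<in> \<Theta>(\<lambda>N. real N)"
    by (rule mean_displacement_linear_bigtheta)
next
  obtain f :: "real \<Rightarrow> real" where pos: "\<And>c. 0 < c \<Longrightarrow> 0 < f c" and anti: "antimono_on {0<..} f"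
    and lim: "\<And>c. 0 < c \<Longrightarrow> isCont f c \<Longrightarrow>
      (\<lambda>N. mean_displacement TYPE('d) N (c / real N) / real N) \<longlonglongrightarrow> f c"
    by (rule mean_displacement_scaling_limit[where 'd='d]) blast
  let ?C = "{c\<in>{0<..}. \<not> isCont f c}"
  have "mono_on {0<..} (\<lambda>c. - f c)" using anti by (simp add: monotone_on_def)
  then have "countable {c\<in>{0<..}. \<not> isCont (\<lambda>c. - f c) c}"
    by (rule mono_on_ctble_discont_open[rotated]) simp
  moreover have "isCont (\<lambda>c. - f c) c \<longleftrightarrow> isCont f c" for c
    using continuous_minus[of "at c" f] continuous_minus[of "at c" "\<lambda>c. - f c"] by auto
  ultimately have "countable ?C" by simp
  moreover have "(\<lambda>N. mean_displacement TYPE('d) N (c / real N)) \<sim>[at_top] (\<lambda>N. real N * f c)"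
    if "c \<in> {0<..} - ?C" for c
  proof (rule asymp_equivI')
    have c: "0 < c" "isCont f c" using that by auto
    have "(\<lambda>N. mean_displacement TYPE('d) N (c / real N) / real N / f c) \<longlonglongrightarrow> f c / f c"
      using pos[OF c(1)] by (intro tendsto_intros lim c) auto
    then show "(\<lambda>N. mean_displacement TYPE('d) N (c / real N) / (real N * f c)) \<longlonglongrightarrow> 1"
      using pos[OF c(1)] by simp
  qed
  ultimately show "\<exists>(f :: real \<Rightarrow> real) (C :: real set).
        (\<forall>c>0. f c > 0) \<and> antimono_on {0<..} f \<and> countable C \<and> C \<subseteq> {0<..} \<and>
        (\<forall>c \<in> {0<..} - C.
           (\<lambda>N. mean_displacement TYPE('d) N (c / real N)) \<sim>[at_top] (\<lambda>N. real N * f c))"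
    using pos anti by (intro exI[of _ f] exI[of _ ?C]) auto
qed

end
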